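(* Let $-\infty<a<b<\infty$ and let $p,q,w:(a,b)\to\mathbb{R}$ be measurable with $p^{-1},q,w\in L^1(a,b)$, $p>0$ and $w\neq 0$ a.e. on $(a,b)$, such that both $\{x\in(a,b):w(x)>0\}$ and $\{x\in(a,b):w(x)<0\}$ have positive Lebesgue measure. Let $\mathcal{D}$ be a selfadjoint domain, let $c(\mathcal{D})$ be the associated constant, and set $$\alpha:=c(\mathcal{D})+\|q_-\|_1,\qquad \beta:=\sqrt{\alpha\bigl(1/\|p^{-1}\|_1+\alpha\bigr)}+\alpha,\qquad \gamma:=\sqrt{2\beta+1/\|p^{-1}\|_1},$$ where $q_-(x):=\min\{0,q(x)\}$. Assume that there exists a real-valued function $g\in \mathrm{AC}[a,b]$ such that $gw>0$ a.e. on $(a,b)$, $g(a)=g(b)=0$, and $g'\in L^2_p(a,b)$. Let $\varepsilon>0$ be such that $$\mu_{\frac1p}\bigl(\{x\in[a,b]:p(x)g(x)w(x)<\varepsilon\}\bigr)\le\frac{1}{2\gamma^2}.$$ Then every real exceptional eigenvalue $\lambda$ of the operator $A(\mathcal{D})$ satisfies $$|\lambda|\le\frac{2}{\varepsilon}\bigl(\beta\,\gamma\,\|g'\|_{p,2}+(\beta^2+\gamma^2\|q\|_1)\|g\|_\infty\bigr).$$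
   Context: Function spaces: $\mathrm{AC}[a,b]$ is the set of absolutely continuous functions on $[a,b]$. For a measurable $r:(a,b)\to[0,\infty)$, $\mu_r$ is the measure on $(a,b)$ with $d\mu_r=r\,dt$, $L^2_r(a,b):=L^2((a,b),\mu_r)$, and $\|\cdot\|_{r,2}$ is its norm, i.e. $\|f\|_{r,2}^2=\int_a^b|f|^2r$. $\|\cdot\|_1$ and $\|\cdot\|_\infty$ are the usual $L^1$- and $L^\infty$-norms on $(a,b)$. Differential expression: $\tau(f)=\frac1w\bigl(-(pf')'+qf\bigr)$. The maximal domain $\mathcal{D}_{\max}$ is the set of all $f:(a,b)\to\mathbb{C}$ in $L^2_{|w|}(a,b)$ such that $f$ and $pf'$ are absolutely continuous on $[a,b]$ and $\tau(f)\in L^2_{|w|}(a,b)$. A selfadjoint domain is a set $\mathcal{D}$ of one of the following two forms: (separated) $\mathcal{D}_{\rm sep}(l,r)=\{f\in\mathcal{D}_{\max}:(pf')(a)=lf(a),\ (pf')(b)=rf(b)\}$ with $l,r\in\mathbb{R}\cup\{\infty\}$, where $l=\infty$ (resp. $r=\infty$) means the Dirichlet condition $f(a)=0$ (resp. $f(b)=0$); (coupled) $\mathcal{D}_{\rm coup}(\varphi,R)=\left\{f\in\mathcal{D}_{\max}:\begin{pmatrix}f(b)\\(pf')(b)\end{pmatrix}=e^{i\varphi}R\begin{pmatrix}f(a)\\(pf')(a)\end{pmatrix}\right\}$ with $\varphi\in[0,2\pi)$ and $R=(r_{ij})_{i,j=1}^2\in\mathbb{R}^{2\times2}$, $\det R=1$.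 The constant $c(\mathcal{D})\ge0$ is defined by: $c(\mathcal{D})=|l|+|r|$ if $\mathcal{D}=\mathcal{D}_{\rm sep}(l,r)$ with $l,r\in\mathbb{R}$; $c(\mathcal{D})=|r|$ if $\mathcal{D}=\mathcal{D}_{\rm sep}(\infty,r)$ with $r\in\mathbb{R}$; $c(\mathcal{D})=|l|$ if $\mathcal{D}=\mathcal{D}_{\rm sep}(l,\infty)$ with $l\in\mathbb{R}$; $c(\mathcal{D})=0$ if $\mathcal{D}=\mathcal{D}_{\rm sep}(\infty,\infty)$; $c(\mathcal{D})=\frac{|r_{11}|+|r_{22}|+2}{|r_{12}|}$ if $\mathcal{D}=\mathcal{D}_{\rm coup}(\varphi,R)$ and $r_{12}\ne0$; $c(\mathcal{D})=|r_{11}r_{21}|$ if $\mathcal{D}=\mathcal{D}_{\rm coup}(\varphi,R)$ and $r_{12}=0$. The operator $A(\mathcal{D})$ in $L^2_{|w|}(a,b)$ is $A(\mathcal{D})f=\tau(f)$ with $\operatorname{dom}A(\mathcal{D})=\mathcal{D}$. Thus $\lambda$ is an eigenvalue of $A(\mathcal{D})$ iff there is $\phi\in\mathcal{D}$, $\phi\neq0$, with $-(p\phi')'+q\phi=\lambda w\phi$ a.e. on $(a,b)$; such $\phi$ is a corresponding eigenfunction. Real exceptional eigenvalues: a real eigenvalue $\lambda\neq0$ of $A(\mathcal{D})$ is called exceptional if it has a corresponding eigenfunction $\phi$ with $\lambda\int_a^b|\phi|^2w\le0$. The number $\lambda=0$ is called an exceptional eigenvalue if there is $\psi$ in the root subspace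 (generalized eigenspace) of $A(\mathcal{D})$ at $0$ with $[A(\mathcal{D})\psi,\psi]<0$, where $[f,h]=\int_a^b f\,\overline{h}\,w$. *)

theory Defs
  imports "HOL-Analysis.Analysis" "HOL-Probability.Essential_Supremum"
begin

definition abs_cont_on :: "real \<Rightarrow> real \<Rightarrow> (real \<Rightarrow> 'a::metric_space) \<Rightarrow> bool" where
  "abs_cont_on a b f \<longleftrightarrow>
     (\<forall>e>0. \<exists>d>0. \<forall>I :: (real \<times> real) set.
        finite I \<longrightarrow> (\<forall>(s, t)\<in>I. a \<le> s \<and> s < t \<and> t \<le> b) \<longrightarrow>
        pairwise (\<lambda>(s, t) (s', t'). {s<..<t} \<inter> {s'<..<t'} = {}) I \<longrightarrow>
        (\<Sum>(s, t)\<in>I. t - s) < d \<longrightarrow> (\<Sum>(s, t)\<in>I. dist (f s) (f t)) < e)"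

text \<open>Functions on \<open>(a,b)\<close> or \<open>[a,b]\<close> are total functions whose values outside the interval
  are irrelevant. Measurability is Lebesgue measurability, since a.e. derivatives need not be Borel
  measurable. The measure \<open>weight_measure a b r\<close> is \<open>\<mu>\<^sub>r\<close>; its space is the open interval \<open>(a,b)\<close>.\<close>

definition weight_measure :: "real \<Rightarrow> real \<Rightarrow> (real \<Rightarrow> real) \<Rightarrow> real measure" where
  "weight_measure a b r = density (lebesgue_on {a<..<b}) (\<lambda>x. ennreal (r x))"

definition L2_weight ::
    "real \<Rightarrow> real \<Rightarrow> (real \<Rightarrow> real) \<Rightarrow> (real \<Rightarrow> 'a::real_normed_vector) set" where
  "L2_weight a b r =
     {f. f \<in> borel_measurable (weight_measure a b r) \<and>
         integrable (weight_measure a b r) (\<lambda>x. (norm (f x))\<^sup>2)}"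

definition norm_L2_weight ::
    "real \<Rightarrow> real \<Rightarrow> (real \<Rightarrow> real) \<Rightarrow> (real \<Rightarrow> 'a::real_normed_vector) \<Rightarrow> real" where
  "norm_L2_weight a b r f = sqrt (LINT x|weight_measure a b r. (norm (f x))\<^sup>2)"

definition norm_L1 :: "real \<Rightarrow> real \<Rightarrow> (real \<Rightarrow> real) \<Rightarrow> real" where
  "norm_L1 a b f = (LINT x|lebesgue_on {a<..<b}. \<bar>f x\<bar>)"

definition norm_Linf :: "real \<Rightarrow> real \<Rightarrow> (real \<Rightarrow> real) \<Rightarrow> real" where
  "norm_Linf a b f = real_of_ereal (esssup (lebesgue_on {a<..<b}) (\<lambda>x. ereal \<bar>f x\<bar>))"

text \<open>Derivatives are a.e. derivatives. Thus ``\<open>p f'\<close> is absolutely continuous on \<open>[a,b]\<close>'' means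
  that \<open>p f'\<close> agrees a.e. on \<open>(a,b)\<close> with an absolutely continuous \<open>u\<close>. For \<open>a < b\<close> this \<open>u\<close> is
  unique on \<open>[a,b]\<close> by continuity; \<open>(p f')(a)\<close> and \<open>(p f')(b)\<close> are its boundary values.\<close>

definition is_quasi_deriv ::
    "real \<Rightarrow> real \<Rightarrow> (real \<Rightarrow> real) \<Rightarrow> (real \<Rightarrow> complex) \<Rightarrow> (real \<Rightarrow> complex) \<Rightarrow> bool" where
  "is_quasi_deriv a b p f u \<longleftrightarrow>
     abs_cont_on a b u \<and>
     (AE x in lebesgue_on {a<..<b}.
        \<exists>d. (f has_vector_derivative d) (at x) \<and> u x = of_real (p x) * d)"

definition quasi_deriv ::
    "real \<Rightarrow> real \<Rightarrow> (real \<Rightarrow> real) \<Rightarrow> (real \<Rightarrow> complex) \<Rightarrow> (real \<Rightarrow> complex)" where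
  "quasi_deriv a b p f = (SOME u. is_quasi_deriv a b p f u)"

definition tau ::
    "real \<Rightarrow> real \<Rightarrow> (real \<Rightarrow> real) \<Rightarrow> (real \<Rightarrow> real) \<Rightarrow> (real \<Rightarrow> real) \<Rightarrow>
     (real \<Rightarrow> complex) \<Rightarrow> (real \<Rightarrow> complex)" where
  "tau a b p q w f =
     (\<lambda>x. (- vector_derivative (quasi_deriv a b p f) (at x) + of_real (q x) * f x) / of_real (w x))"

text \<open>By Lebesgue's theorem an absolutely continuous function is differentiable a.e., so the
  differentiability clause below (and the existence of \<open>d\<close> in \<open>is_quasi_deriv\<close>) restricts nothing;
  it records that the derivatives in \<open>tau\<close> are genuine.\<close>

definition D_max ::
    "real \<Rightarrow> real \<Rightarrow> (real \<Rightarrow> real) \<Rightarrow> (real \<Rightarrow> real) \<Rightarrow> (real \<Rightarrow> real) \<Rightarrow> (real \<Rightarrow> complex) set" where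
  "D_max a b p q w =
     {f. f \<in> L2_weight a b (\<lambda>x. \<bar>w x\<bar>) \<and>
         abs_cont_on a b f \<and>
         (\<exists>u. is_quasi_deriv a b p f u) \<and>
         (AE x in lebesgue_on {a<..<b}. quasi_deriv a b p f differentiable (at x)) \<and>
         tau a b p q w f \<in> L2_weight a b (\<lambda>x. \<bar>w x\<bar>)}"

text \<open>\<open>Dirichlet\<close> is the value \<open>\<infinity>\<close> of a separated boundary parameter.\<close>

datatype end_cond = Robin real | Dirichlet

datatype bound_cond = Separated end_cond end_cond | Coupled real "real^2^2"

fun admissible :: "bound_cond \<Rightarrow> bool" where
  "admissible (Separated l r) \<longleftrightarrow> True"
| "admissible (Coupled \<phi> R) \<longleftrightarrow> 0 \<le> \<phi> \<and> \<phi> < 2 * pi \<and> det R = 1"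

text \<open>The arguments \<open>y\<close> and \<open>y1\<close> stand for \<open>f\<close> and \<open>p f'\<close> at the endpoint.\<close>

fun end_cond_holds :: "end_cond \<Rightarrow> complex \<Rightarrow> complex \<Rightarrow> bool" where
  "end_cond_holds (Robin l) y y1 \<longleftrightarrow> y1 = of_real l * y"
| "end_cond_holds Dirichlet y y1 \<longleftrightarrow> y = 0"

fun sa_domain ::
    "real \<Rightarrow> real \<Rightarrow> (real \<Rightarrow> real) \<Rightarrow> (real \<Rightarrow> real) \<Rightarrow> (real \<Rightarrow> real) \<Rightarrow> bound_cond \<Rightarrow>
     (real \<Rightarrow> complex) set" where
  "sa_domain a b p q w (Separated l r) =
     {f \<in> D_max a b p q w.
        end_cond_holds l (f a) (quasi_deriv a b p f a) \<and>
        end_cond_holds r (f b) (quasi_deriv a b p f b)}"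
| "sa_domain a b p q w (Coupled \<phi> R) =
     {f \<in> D_max a b p q w.
        f b = cis \<phi> * (of_real (R$1$1) * f a + of_real (R$1$2) * quasi_deriv a b p f a) \<and>
        quasi_deriv a b p f b =
          cis \<phi> * (of_real (R$2$1) * f a + of_real (R$2$2) * quasi_deriv a b p f a)}"

text \<open>The constant is attached to the parameters rather than to the domain. This is harmless: a
  domain determines its parameters, except that \<open>(\<phi>, R)\<close> may be replaced by
  \<open>(\<phi> \<plusminus> \<pi>, - R)\<close>, which leaves the constant unchanged.\<close>

fun bc_const :: "bound_cond \<Rightarrow> real" where
  "bc_const (Separated (Robin l) (Robin r)) = \<bar>l\<bar> + \<bar>r\<bar>"
| "bc_const (Separated Dirichlet (Robin r)) = \<bar>r\<bar>"
| "bc_const (Separated (Robin l) Dirichlet) = \<bar>l\<bar>"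
| "bc_const (Separated Dirichlet Dirichlet) = 0"
| "bc_const (Coupled \<phi> R) =
     (if R$1$2 \<noteq> 0 then (\<bar>R$1$1\<bar> + \<bar>R$2$2\<bar> + 2) / \<bar>R$1$2\<bar> else \<bar>R$1$1 * R$2$1\<bar>)"

definition is_eigenfunction ::
    "real \<Rightarrow> real \<Rightarrow> (real \<Rightarrow> real) \<Rightarrow> (real \<Rightarrow> real) \<Rightarrow> (real \<Rightarrow> real) \<Rightarrow> bound_cond \<Rightarrow>
     complex \<Rightarrow> (real \<Rightarrow> complex) \<Rightarrow> bool" where
  "is_eigenfunction a b p q w D z \<phi> \<longleftrightarrow>
     \<phi> \<in> sa_domain a b p q w D \<and>
     \<not> (AE x in lebesgue_on {a<..<b}. \<phi> x = 0) \<and>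
     (AE x in lebesgue_on {a<..<b}.
        - vector_derivative (quasi_deriv a b p \<phi>) (at x) + of_real (q x) * \<phi> x
          = z * of_real (w x) * \<phi> x)"

text \<open>The elements of \<open>L\<^sup>2\<close> are classes modulo a.e. equality, so \<open>(A - z)\<^sup>n \<psi> = 0\<close> is witnessed
  by a chain of functions in the domain, each of which represents the image under \<open>A - z\<close> of its
  predecessor.\<close>

definition root_subspace ::
    "real \<Rightarrow> real \<Rightarrow> (real \<Rightarrow> real) \<Rightarrow> (real \<Rightarrow> real) \<Rightarrow> (real \<Rightarrow> real) \<Rightarrow> bound_cond \<Rightarrow>
     complex \<Rightarrow> (real \<Rightarrow> complex) set" where
  "root_subspace a b p q w D z =
     {\<psi> \<in> sa_domain a b p q w D.
        \<exists>(n::nat) \<Psi>. \<Psi> 0 = \<psi> \<and>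
          (\<forall>i<n. \<Psi> i \<in> sa_domain a b p q w D \<and>
             (AE x in lebesgue_on {a<..<b}. \<Psi> (Suc i) x = tau a b p q w (\<Psi> i) x - z * \<Psi> i x)) \<and>
          (AE x in lebesgue_on {a<..<b}. \<Psi> n x = 0)}"

definition indef_inner ::
    "real \<Rightarrow> real \<Rightarrow> (real \<Rightarrow> real) \<Rightarrow> (real \<Rightarrow> complex) \<Rightarrow> (real \<Rightarrow> complex) \<Rightarrow> complex" where
  "indef_inner a b w f h = (LINT x|lebesgue_on {a<..<b}. f x * cnj (h x) * of_real (w x))"

definition real_exceptional ::
    "real \<Rightarrow> real \<Rightarrow> (real \<Rightarrow> real) \<Rightarrow> (real \<Rightarrow> real) \<Rightarrow> (real \<Rightarrow> real) \<Rightarrow> bound_cond \<Rightarrow>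
     real \<Rightarrow> bool" where
  "real_exceptional a b p q w D lam \<longleftrightarrow>
     (if lam \<noteq> 0
      then (\<exists>\<phi>. is_eigenfunction a b p q w D (of_real lam) \<phi> \<and>
             lam * (LINT x|lebesgue_on {a<..<b}. (norm (\<phi> x))\<^sup>2 * w x) \<le> 0)
      else (\<exists>\<psi>\<in>root_subspace a b p q w D 0. \<exists>s<0.
             indef_inner a b w (tau a b p q w \<psi>) \<psi> = complex_of_real s))"

end

theory Submission
  imports Defs
begin

text \<open>
  Let \<open>\<phi>\<close> be an eigenfunction for \<open>\<lambda> \<noteq> 0\<close> with \<open>\<lambda> \<integral>|\<phi>|\<^sup>2 w \<le> 0\<close>, and put \<open>u = p \<phi>'\<close>,
  \<open>N\<^sup>2 = \<integral>|\<phi>|\<^sup>2/p\<close>, \<open>K\<^sup>2 = \<integral>|u|\<^sup>2/p = \<integral> p |\<phi>'|\<^sup>2\<close>, \<open>M = sup |\<phi>|\<close> and \<open>P = \<integral> 1/p\<close>. Testing the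
  equation with \<open>\<phi>\<close> gives \<open>K\<^sup>2 \<le> \<alpha> M\<^sup>2\<close>, because the boundary form is at most \<open>c(D) M\<^sup>2\<close>.
  Averaging \<open>M\<^sup>2 - |\<phi>(y)|\<^sup>2 \<le> 2 N K\<close> over \<open>y\<close> with respect to \<open>dy/p(y)\<close> gives
  \<open>M\<^sup>2 \<le> N\<^sup>2/P + 2 N K\<close>. Since \<open>\<gamma>\<close> is the positive root of \<open>x\<^sup>2 = 1/P + 2 \<surd>\<alpha> x\<close> and
  \<open>\<beta> = \<surd>\<alpha> \<gamma>\<close>, it follows that \<open>M \<le> \<gamma> N\<close> and \<open>K \<le> \<beta> N\<close>. Testing the equation with \<open>g \<phi>\<close>
  then bounds \<open>|\<lambda>| \<integral> g w |\<phi>|\<^sup>2\<close> from above, and the condition on \<open>\<epsilon>\<close> gives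
  \<open>\<integral> g w |\<phi>|\<^sup>2 \<ge> \<epsilon> N\<^sup>2/2\<close>.
\<close>

section \<open>Absolutely continuous functions\<close>

lemma abs_cont_onE:
  assumes "abs_cont_on a b f" "e > 0"
  obtains \<delta> where "\<delta> > 0" "\<And>I :: (real \<times> real) set.
      finite I \<Longrightarrow> (\<forall>(s, t)\<in>I. a \<le> s \<and> s < t \<and> t \<le> b) \<Longrightarrow>
      pairwise (\<lambda>(s, t) (s', t'). {s<..<t} \<inter> {s'<..<t'} = {}) I \<Longrightarrow>
      (\<Sum>(s, t)\<in>I. t - s) < \<delta> \<Longrightarrow> (\<Sum>(s, t)\<in>I. dist (f s) (f t)) < e"
  using assms unfolding abs_cont_on_def by meson

lemma abs_cont_on_subinterval:
  assumes "abs_cont_on a b f" "a \<le> c" "d \<le> b"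
  shows "abs_cont_on c d f"
  unfolding abs_cont_on_def
proof (intro allI impI)
  fix e :: real assume "e > 0"
  obtain \<delta> where "\<delta> > 0" and \<delta>: "\<And>I :: (real \<times> real) set.
      finite I \<Longrightarrow> (\<forall>(s, t)\<in>I. a \<le> s \<and> s < t \<and> t \<le> b) \<Longrightarrow>
      pairwise (\<lambda>(s, t) (s', t'). {s<..<t} \<inter> {s'<..<t'} = {}) I \<Longrightarrow>
      (\<Sum>(s, t)\<in>I. t - s) < \<delta> \<Longrightarrow> (\<Sum>(s, t)\<in>I. dist (f s) (f t)) < e"
    by (fact abs_cont_onE[OF assms(1) \<open>e > 0\<close>])
  show "\<exists>\<delta>>0. \<forall>I :: (real \<times> real) set.
      finite I \<longrightarrow> (\<forall>(s, t)\<in>I. c \<le> s \<and> s < t \<and> t \<le> d) \<longrightarrow>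
      pairwise (\<lambda>(s, t) (s', t'). {s<..<t} \<inter> {s'<..<t'} = {}) I \<longrightarrow>
      (\<Sum>(s, t)\<in>I. t - s) < \<delta> \<longrightarrow> (\<Sum>(s, t)\<in>I. dist (f s) (f t)) < e"
    using \<open>\<delta> > 0\<close> assms(2,3) by (intro exI[of _ \<delta>] conjI allI impI \<delta>) fastforce+
qed

lemma abs_cont_on_const [simp]: "abs_cont_on a b (\<lambda>x. c)"
  unfolding abs_cont_on_def by (auto intro!: exI[of _ 1])

lemma abs_cont_on_imp_continuous_on:
  assumes "abs_cont_on a b f"
  shows "continuous_on {a..b} f"
  unfolding continuous_on_iff
proof (intro ballI allI impI)
  fix x e :: real assume x: "x \<in> {a..b}" and "e > 0"
  obtain \<delta> where "\<delta> > 0" and \<delta>: "\<And>I :: (real \<times> real) set.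
      finite I \<Longrightarrow> (\<forall>(s, t)\<in>I. a \<le> s \<and> s < t \<and> t \<le> b) \<Longrightarrow>
      pairwise (\<lambda>(s, t) (s', t'). {s<..<t} \<inter> {s'<..<t'} = {}) I \<Longrightarrow>
      (\<Sum>(s, t)\<in>I. t - s) < \<delta> \<Longrightarrow> (\<Sum>(s, t)\<in>I. dist (f s) (f t)) < e"
    by (fact abs_cont_onE[OF assms \<open>e > 0\<close>])
  \<comment> \<open>One interval is already an admissible family. Which of \<open>{(x, y)}\<close>
    and \<open>{(y, x)}\<close> is correctly oriented depends on the order of \<open>x\<close> and
    \<open>y\<close>.\<close>
  have "dist (f y) (f x) < e" if y: "y \<in> {a..b}" "dist y x < \<delta>" for y
    using \<delta>[of "{(x, y)}"] \<delta>[of "{(y, x)}"] x y \<open>e > 0\<close>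
    by (cases x y rule: linorder_cases) (auto simp: dist_real_def dist_commute)
  then show "\<exists>d>0. \<forall>y\<in>{a..b}. dist y x < d \<longrightarrow> dist (f y) (f x) < e"
    using \<open>\<delta> > 0\<close> by blast
qed

lemma continuous_on_Icc_norm_bound:
  fixes f :: "real \<Rightarrow> 'a::real_normed_vector"
  assumes "continuous_on {a..b} f"
  obtains B where "B > 0" "\<And>x. x \<in> {a..b} \<Longrightarrow> norm (f x) \<le> B"
proof -
  have "bounded (f ` {a..b})"
    using assms compact_continuous_image compact_imp_bounded by blast
  then show ?thesis
    using that unfolding bounded_pos by auto
qed

text \<open>The increment of a product splits into two terms, each an increment of one factor times
  a bound of the other. A general bilinear map covers both products needed later: real
  multiplication and the inner product.\<close>

lemma (in bounded_bilinear) abs_cont_on: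
  assumes f: "abs_cont_on a b f" and g: "abs_cont_on a b g"
  shows "abs_cont_on a b (\<lambda>x. prod (f x) (g x))"
  unfolding abs_cont_on_def
proof (intro allI impI)
  fix e :: real assume "e > 0"
  obtain K where "K > 0" and K: "\<And>x y. norm (prod x y) \<le> norm x * norm y * K"
    using pos_bounded by blast
  obtain A where "A > 0" and A: "\<And>x. x \<in> {a..b} \<Longrightarrow> norm (f x) \<le> A"
    using continuous_on_Icc_norm_bound[OF abs_cont_on_imp_continuous_on[OF f]] by blast
  obtain B where "B > 0" and B: "\<And>x. x \<in> {a..b} \<Longrightarrow> norm (g x) \<le> B"
    using continuous_on_Icc_norm_bound[OF abs_cont_on_imp_continuous_on[OF g]] by blast
  \<comment> \<open>Chosen so that \<open>K * (B * \<eta> + A * \<eta>) = e\<close>.\<close>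
  define \<eta> where "\<eta> = e / (K * (A + B))"
  have "\<eta> > 0" using \<open>e > 0\<close> \<open>K > 0\<close> \<open>A > 0\<close> \<open>B > 0\<close> by (simp add: \<eta>_def)
  obtain \<delta>1 where "\<delta>1 > 0" and \<delta>1: "\<And>I :: (real \<times> real) set.
      finite I \<Longrightarrow> (\<forall>(s, t)\<in>I. a \<le> s \<and> s < t \<and> t \<le> b) \<Longrightarrow>
      pairwise (\<lambda>(s, t) (s', t'). {s<..<t} \<inter> {s'<..<t'} = {}) I \<Longrightarrow>
      (\<Sum>(s, t)\<in>I. t - s) < \<delta>1 \<Longrightarrow> (\<Sum>(s, t)\<in>I. dist (f s) (f t)) < \<eta>"
    by (fact abs_cont_onE[OF f \<open>\<eta> > 0\<close>])
  obtain \<delta>2 where "\<delta>2 > 0" and \<delta>2: "\<And>I :: (real \<times> real) set.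
      finite I \<Longrightarrow> (\<forall>(s, t)\<in>I. a \<le> s \<and> s < t \<and> t \<le> b) \<Longrightarrow>
      pairwise (\<lambda>(s, t) (s', t'). {s<..<t} \<inter> {s'<..<t'} = {}) I \<Longrightarrow>
      (\<Sum>(s, t)\<in>I. t - s) < \<delta>2 \<Longrightarrow> (\<Sum>(s, t)\<in>I. dist (g s) (g t)) < \<eta>"
    by (fact abs_cont_onE[OF g \<open>\<eta> > 0\<close>])
  have *: "dist (prod (f s) (g s)) (prod (f t) (g t))
             \<le> K * (B * dist (f s) (f t) + A * dist (g s) (g t))"
    if "s \<in> {a..b}" "t \<in> {a..b}" for s t
  proof -
    have "prod (f s) (g s) - prod (f t) (g t) = prod (f s - f t) (g s) + prod (f t) (g s - g t)"
      by (simp add: diff_left diff_right)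
    then have "norm (prod (f s) (g s) - prod (f t) (g t))
             \<le> norm (f s - f t) * norm (g s) * K + norm (f t) * norm (g s - g t) * K"
      by (metis K add_mono norm_triangle_le)
    also have "\<dots> \<le> norm (f s - f t) * B * K + A * norm (g s - g t) * K"
      using A B that \<open>K > 0\<close> \<open>A > 0\<close> \<open>B > 0\<close> by (intro add_mono mult_mono) auto
    finally show ?thesis by (simp add: dist_norm algebra_simps)
  qed
  show "\<exists>\<delta>>0. \<forall>I :: (real \<times> real) set.
      finite I \<longrightarrow> (\<forall>(s, t)\<in>I. a \<le> s \<and> s < t \<and> t \<le> b) \<longrightarrow>
      pairwise (\<lambda>(s, t) (s', t'). {s<..<t} \<inter> {s'<..<t'} = {}) I \<longrightarrow>
      (\<Sum>(s, t)\<in>I. t - s) < \<delta> \<longrightarrow>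
      (\<Sum>(s, t)\<in>I. dist (prod (f s) (g s)) (prod (f t) (g t))) < e"
  proof (intro exI[of _ "min \<delta>1 \<delta>2"] conjI allI impI)
    fix I :: "(real \<times> real) set"
    assume I: "finite I" "\<forall>(s, t)\<in>I. a \<le> s \<and> s < t \<and> t \<le> b"
      "pairwise (\<lambda>(s, t) (s', t'). {s<..<t} \<inter> {s'<..<t'} = {}) I"
      "(\<Sum>(s, t)\<in>I. t - s) < min \<delta>1 \<delta>2"
    have "(\<Sum>(s, t)\<in>I. dist (prod (f s) (g s)) (prod (f t) (g t)))
        \<le> (\<Sum>(s, t)\<in>I. K * (B * dist (f s) (f t) + A * dist (g s) (g t)))"
      using I(2) by (intro sum_mono) (auto intro!: *)
    also have "\<dots> = K * (B * (\<Sum>(s, t)\<in>I. dist (f s) (f t)) + A * (\<Sum>(s, t)\<in>I. dist (g s) (g t)))"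
      by (simp add: sum_distrib_left[symmetric] sum.distrib split_def)
    also have "\<dots> < K * (B * \<eta> + A * \<eta>)"
      using \<delta>1[OF I(1-3)] \<delta>2[OF I(1-3)] I(4) \<open>K > 0\<close> \<open>A > 0\<close> \<open>B > 0\<close>
      by (intro mult_strict_left_mono add_strict_mono) auto
    also have "\<dots> = e"
    proof -
      have "K * (A + B) \<noteq> 0" using \<open>K > 0\<close> \<open>A > 0\<close> \<open>B > 0\<close> by simp
      then have "K * (A + B) * \<eta> = e" by (simp add: \<eta>_def)
      then show ?thesis by (simp add: algebra_simps)
    qed
    finally show "(\<Sum>(s, t)\<in>I. dist (prod (f s) (g s)) (prod (f t) (g t))) < e" .
  qed (use \<open>\<delta>1 > 0\<close> \<open>\<delta>2 > 0\<close> in auto)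
qed

text \<open>In the gauge below, tags at which \<open>f\<close> is not differentiable have their intervals inside an
  open set of small measure, so absolute continuity makes their total increment small; the other
  tags are treated as for an everywhere differentiable function.\<close>

lemma abs_cont_on_has_integral:
  fixes f :: "real \<Rightarrow> 'a::banach"
  assumes "a \<le> b" and ac: "abs_cont_on a b f"
    and der: "AE x in lebesgue_on {a<..<b}. (f has_vector_derivative f' x) (at x)"
  shows "(f' has_integral (f b - f a)) {a..b}"
proof -
  have "AE x in lebesgue. x \<in> {a<..<b} \<longrightarrow> (f has_vector_derivative f' x) (at x)"
    using der AE_restrict_space_iff[of "{a<..<b}" lebesgue] by simp
  then obtain N where N: "N \<in> null_sets lebesgue"
    "{x. \<not> (x \<in> {a<..<b} \<longrightarrow> (f has_vector_derivative f' x) (at x))} \<subseteq> N"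
    unfolding eventually_ae_filter by (auto simp del: not_imp)
  \<comment> \<open>The derivative is known on the open interval only, so the endpoints join the
    exceptional null set.\<close>
  define S where "S = N \<union> {a, b}"
  have negS: "negligible S"
    using N(1) by (simp add: S_def negligible_iff_null_sets[symmetric] negligible_Un)
  \<comment> \<open>With value 0 on \<open>S\<close>, a tag in \<open>S\<close> contributes just the
    increment of \<open>f\<close> to the error. The change on a null set is undone at the
    end.\<close>
  define h where "h = (\<lambda>x. if x \<in> S then 0 else f' x)"
  have dh: "(f has_vector_derivative h x) (at x within {a..b})" if "x \<in> {a..b} - S" for x
  proof -
    have "x \<in> {a<..<b}" "x \<notin> N" using that by (auto simp: S_def)
    then have "(f has_vector_derivative f' x) (at x)" using N(2) by blast
    then show ?thesis using that by (simp add: h_def has_vector_derivative_at_within)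
  qed
  have "(h has_integral (f b - f a)) (cbox a b)"
    unfolding has_integral_factor_content
  proof (intro allI impI)
    fix e :: real assume "e > 0"
    show "\<exists>d. gauge d \<and> (\<forall>p. p tagged_division_of cbox a b \<and> d fine p \<longrightarrow>
      norm ((\<Sum>(x,k)\<in>p. measure lborel k *\<^sub>R h x) - (f b - f a)) \<le> e * measure lborel (cbox a b))"
    proof (cases "a = b")
      case True
      then show ?thesis
        using sum_content_null[of a b _ h] by (auto intro!: exI[of _ "\<lambda>x. ball x 1"])
    next
      case False
      with \<open>a \<le> b\<close> have "a < b" by simp
      \<comment> \<open>The permitted error \<open>e * (b - a)\<close> is shared equally:
        \<open>e3\<close> for the tags in \<open>S\<close>, \<open>e2 * (b - a)\<close> for the
        others.\<close>
      define e2 where "e2 = e / 2"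
      define e3 where "e3 = e * (b - a) / 2"
      have "e2 > 0" "e3 > 0" using \<open>e > 0\<close> \<open>a < b\<close> by (auto simp: e2_def e3_def)
      obtain \<delta> where "\<delta> > 0" and \<delta>: "\<And>I :: (real \<times> real) set.
          finite I \<Longrightarrow> (\<forall>(s, t)\<in>I. a \<le> s \<and> s < t \<and> t \<le> b) \<Longrightarrow>
          pairwise (\<lambda>(s, t) (s', t'). {s<..<t} \<inter> {s'<..<t'} = {}) I \<Longrightarrow>
          (\<Sum>(s, t)\<in>I. t - s) < \<delta> \<Longrightarrow> (\<Sum>(s, t)\<in>I. dist (f s) (f t)) < e3"
        by (fact abs_cont_onE[OF ac \<open>e3 > 0\<close>])
      have nullS: "S \<in> null_sets lebesgue" using negS negligible_iff_null_sets by blast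
      then obtain T where T: "open T" "S \<subseteq> T" "T - S \<in> lmeasurable" "emeasure lebesgue (T - S) < ennreal \<delta>"
        using sets_lebesgue_outer_open[of S \<delta>] \<open>\<delta> > 0\<close> by blast
      have Tm: "T \<in> lmeasurable"
        using fmeasurable.Un[OF negligible_imp_measurable[OF negS] T(3)] T(2) by (simp add: Un_absorb1)
      have "measure lebesgue T = measure lebesgue (T - S)"
        using nullS T(1) by (simp add: measure_Diff_null_set)
      also have "\<dots> < \<delta>"
        using T(3,4) \<open>\<delta> > 0\<close> by (simp add: emeasure_eq_measure2 ennreal_less_iff)
      finally have Tlt: "measure lebesgue T < \<delta>" .
      have "\<exists>d>0. ball x d \<subseteq> T" if "x \<in> S" for x
        using T(1,2) that by (auto simp: open_contains_ball)
      then have "\<exists>dS. \<forall>x\<in>S. dS x > 0 \<and> ball x (dS x) \<subseteq> T"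
        by (intro bchoice) auto
      then obtain dS where dS: "\<And>x. x \<in> S \<Longrightarrow> dS x > 0" "\<And>x. x \<in> S \<Longrightarrow> ball x (dS x) \<subseteq> T"
        by blast
      have "\<exists>d>0. x \<in> {a..b} - S \<longrightarrow>
         (\<forall>y\<in>{a..b}. norm (y-x) < d \<longrightarrow> norm (f y - f x - (y-x) *\<^sub>R h x) \<le> e2 * norm (y-x))" for x
        using dh[of x, unfolded has_vector_derivative_def has_derivative_within_alt] \<open>e2 > 0\<close>
        by (cases "x \<in> {a..b} - S") (auto intro: exI[of _ 1])
      then obtain dR where dR: "\<And>x. 0 < dR x"
          "\<And>x y. \<lbrakk>x \<in> {a..b} - S; y \<in> {a..b}; norm (y-x) < dR x\<rbrakk>
                   \<Longrightarrow> norm (f y - f x - (y-x) *\<^sub>R h x) \<le> e2 * norm (y-x)"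
        by metis
      define d where "d = (\<lambda>x. ball x (if x \<in> S then dS x else dR x))"
      have "gauge d" unfolding d_def using dS(1) dR(1) by (intro gauge_ball_dependent) auto
      moreover have "norm ((\<Sum>(x, K)\<in>p. measure lborel K *\<^sub>R h x) - (f b - f a)) \<le> e * measure lborel (cbox a b)"
        if ptag: "p tagged_division_of cbox a b" and finep: "d fine p" for p
      proof -
        note p = tagged_division_ofD[OF ptag]
        have ba: "b - a = (\<Sum>(x,K)\<in>p. Sup K - Inf K)" "f b - f a = (\<Sum>(x,K)\<in>p. f(Sup K) - f(Inf K))"
          using additive_tagged_division_1[where f= "\<lambda>x. x"] additive_tagged_division_1[where f= f]
            \<open>a \<le> b\<close> ptag by auto
        have K: "\<exists>u v. K = {u..v} \<and> u \<le> v \<and> a \<le> u \<and> v \<le> b \<and> x \<in> K \<and> Inf K = u \<and> Sup K = v \<and> measure lborel K = v - u"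
          if "(x, K) \<in> p" for x K
        proof -
          obtain u v where "K = cbox u v" using p(4)[OF \<open>(x, K) \<in> p\<close>] by blast
          moreover have "x \<in> K" "K \<subseteq> cbox a b" using p(2,3) that by auto
          ultimately show ?thesis by (intro exI[of _ u] exI[of _ v]) auto
        qed
        define F where "F = (\<lambda>(x, K). measure lborel K *\<^sub>R h x - (f (Sup K) - f (Inf K)))"
        \<comment> \<open>Degenerate intervals are excluded because absolute continuity speaks of
          \<open>s < t\<close>; in the remaining sum their terms are 0.\<close>
        define p1 where "p1 = {(x, K) \<in> p. x \<in> S \<and> Inf K < Sup K}"
        have fin: "finite p1" using p(1) by (auto simp: p1_def intro: finite_subset[rotated])
        have F1: "norm (sum F p1) \<le> e3"
        proof -
          define j where "j = (\<lambda>(x :: real, K :: real set). (Inf K, Sup K))"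
          have disj: "{Inf K<..<Sup K} \<inter> {Inf L<..<Sup L} = {}"
            if "(x, K) \<in> p" "(y, L) \<in> p" "(x, K) \<noteq> (y, L)" for x y K L
          proof -
            have "interior K = {Inf K<..<Sup K}" "interior L = {Inf L<..<Sup L}"
              using K[OF that(1)] K[OF that(2)] by (metis interior_atLeastAtMost_real)+
            then show ?thesis using p(5)[OF that] by simp
          qed
          \<comment> \<open>Forgetting the tags identifies nothing: two distinct members with equal
            endpoints would have overlapping interiors.\<close>
          have inj: "inj_on j p1"
          proof (rule inj_onI, clarify)
            fix x K y L assume A: "(x, K) \<in> p1" "(y, L) \<in> p1" "j (x, K) = j (y, L)"
            then have eq: "Inf L = Inf K" "Sup L = Sup K" and "Inf K < Sup K"
              by (simp_all add: j_def p1_def)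
            then have "{Inf K<..<Sup K} \<inter> {Inf L<..<Sup L} \<noteq> {}"
              unfolding eq by simp
            then show "x = y \<and> K = L" using disj[of x K y L] A(1,2) unfolding p1_def by blast
          qed
          have sum_j: "(\<Sum>(s, t)\<in>j ` p1. G s t) = (\<Sum>(x, K)\<in>p1. G (Inf K) (Sup K))" for G :: "real \<Rightarrow> real \<Rightarrow> real"
            unfolding sum.reindex[OF inj] by (simp add: j_def split_def comp_def)
          have "(\<Sum>(s, t)\<in>j ` p1. dist (f s) (f t)) < e3"
          proof (rule \<delta>)
            show "finite (j ` p1)" using fin by simp
            show "\<forall>(s, t)\<in>j ` p1. a \<le> s \<and> s < t \<and> t \<le> b"
              by (auto simp: j_def p1_def dest!: K)
            show "pairwise (\<lambda>(s, t) (s', t'). {s<..<t} \<inter> {s'<..<t'} = {}) (j ` p1)"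
            proof (unfold pairwise_image, rule pairwiseI, rule impI)
              fix z z' assume A: "z \<in> p1" "z' \<in> p1" "j z \<noteq> j z'"
              obtain x K y L where "z = (x, K)" "z' = (y, L)" by (cases z, cases z') simp
              with A show "(\<lambda>(s, t) (s', t'). {s<..<t} \<inter> {s'<..<t'} = {}) (j z) (j z')"
                using disj[of x K y L] by (auto simp: j_def p1_def)
            qed
            \<comment> \<open>By disjointness the total length is the measure of the union, and the
              gauge keeps every interval tagged in \<open>S\<close> inside \<open>T\<close>.\<close>
            have "(\<Sum>(s, t)\<in>j ` p1. t - s) = (\<Sum>z\<in>p1. measure lebesgue {Inf (snd z)<..<Sup (snd z)})"
              unfolding sum_j by (intro sum.cong) (auto simp: p1_def)
            also have "\<dots> = measure lebesgue (\<Union>z\<in>p1. {Inf (snd z)<..<Sup (snd z)})"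
            proof (rule measure_UNION'[symmetric])
              show "pairwise (\<lambda>z z'. disjnt {Inf (snd z)<..<Sup (snd z)} {Inf (snd z')<..<Sup (snd z')}) p1"
              proof (rule pairwiseI)
                fix z z' assume "z \<in> p1" "z' \<in> p1" "z \<noteq> z'"
                then show "disjnt {Inf (snd z)<..<Sup (snd z)} {Inf (snd z')<..<Sup (snd z')}"
                  using disj[of "fst z" "snd z" "fst z'" "snd z'"]
                  unfolding disjnt_def p1_def by force
              qed
            qed (use fin in simp_all)
            also have "\<dots> \<le> measure lebesgue T"
            proof (rule measure_mono_fmeasurable[OF _ _ Tm])
              show "(\<Union>z\<in>p1. {Inf (snd z)<..<Sup (snd z)}) \<subseteq> T"
              proof clarify
                fix x K y assume A: "(x, K) \<in> p1" "y \<in> {Inf (snd (x, K))<..<Sup (snd (x, K))}"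
                then have "(x, K) \<in> p" "x \<in> S" by (auto simp: p1_def)
                then have "K \<subseteq> ball x (dS x)" using fineD[OF finep \<open>(x, K) \<in> p\<close>] by (simp add: d_def)
                moreover have "{Inf K..Sup K} = K" using K[OF \<open>(x, K) \<in> p\<close>] by metis
                moreover have "y \<in> {Inf K..Sup K}" using A(2) by simp
                ultimately show "y \<in> T" using dS(2)[OF \<open>x \<in> S\<close>] by blast
              qed
              show "(\<Union>z\<in>p1. {Inf (snd z)<..<Sup (snd z)}) \<in> sets lebesgue"
                using fin by (intro sets.finite_UN) simp_all
            qed
            finally show "(\<Sum>(s, t)\<in>j ` p1. t - s) < \<delta>" using Tlt by simp
          qed
          moreover have "norm (sum F p1) \<le> (\<Sum>(x, K)\<in>p1. dist (f (Inf K)) (f (Sup K)))"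
            by (rule sum_norm_le)
              (auto simp: F_def p1_def h_def dist_norm norm_minus_commute)
          ultimately show ?thesis by (simp add: sum_j)
        qed
        have F2: "norm (sum F (p - p1)) \<le> e2 * (b - a)"
        proof -
          have "norm (sum F (p - p1)) \<le> (\<Sum>z\<in>p - p1. e2 * (case z of (x, K) \<Rightarrow> Sup K - Inf K))"
          proof (rule sum_norm_le, clarify)
            fix x K assume "(x, K) \<in> p" "(x, K) \<notin> p1"
            obtain u v where uv: "K = {u..v}" "u \<le> v" "a \<le> u" "v \<le> b" "x \<in> K" "Inf K = u" "Sup K = v" "measure lborel K = v - u"
              using K[OF \<open>(x, K) \<in> p\<close>] by blast
            show "norm (F (x, K)) \<le> e2 * (Sup K - Inf K)"
            proof (cases "x \<in> S")
              case True
              then have "u = v" using \<open>(x, K) \<in> p\<close> \<open>(x, K) \<notin> p1\<close> uv by (auto simp: p1_def)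
              then show ?thesis using uv by (simp add: F_def)
            next
              case False
              have Kb: "K \<subseteq> ball x (dR x)"
                using fineD[OF finep \<open>(x, K) \<in> p\<close>] False by (simp add: d_def)
              \<comment> \<open>Straddle estimate: the interval is cut at its tag and
                differentiability is used on either side. As \<open>u \<le> x \<le> v\<close>, the
                two lengths add up to \<open>v - u\<close>.\<close>
              have "norm ((v - u) *\<^sub>R h x - (f v - f u)) = norm (f u - f x - (u - x) *\<^sub>R h x - (f v - f x - (v - x) *\<^sub>R h x))"
                by (auto simp: algebra_simps)
              also have "\<dots> \<le> norm (f u - f x - (u - x) *\<^sub>R h x) + norm (f v - f x - (v - x) *\<^sub>R h x)"
                by (rule norm_triangle_ineq4)
              also have "\<dots> \<le> e2 * norm (u - x) + e2 * norm (v - x)"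
              proof -
                have "u \<in> ball x (dR x)" "v \<in> ball x (dR x)" using Kb uv(1,2) by auto
                then have "norm (u - x) < dR x" "norm (v - x) < dR x"
                  by (simp_all add: dist_real_def abs_minus_commute)
                then show ?thesis using uv(2-5) False uv(1) by (intro add_mono dR(2)) simp_all
              qed
              also have "\<dots> = e2 * (v - u)" using uv by (auto simp: algebra_simps)
              finally show ?thesis using uv by (simp add: F_def)
            qed
          qed
          also have "\<dots> \<le> (\<Sum>z\<in>p. e2 * (case z of (x, K) \<Rightarrow> Sup K - Inf K))"
          proof (rule sum_mono2)
            have "Inf K \<le> Sup K" if "(x, K) \<in> p" for x K
              using K[OF that] by metis
            then show "0 \<le> e2 * (case z of (x, K) \<Rightarrow> Sup K - Inf K)" if "z \<in> p - (p - p1)" for z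
              using that \<open>e2 > 0\<close> by (cases z) (auto simp: zero_le_mult_iff)
          qed (use p(1) in simp_all)
          also have "\<dots> = e2 * (b - a)" by (simp add: ba(1) sum_distrib_left)
          finally show ?thesis .
        qed
        have "(\<Sum>(x, K)\<in>p. measure lborel K *\<^sub>R h x) - (f b - f a) = sum F p"
          by (simp add: ba(2) F_def sum_subtractf split_def)
        also have "\<dots> = sum F (p - p1) + sum F p1"
          using p(1) by (intro sum.subset_diff) (auto simp: p1_def)
        finally have "norm ((\<Sum>(x, K)\<in>p. measure lborel K *\<^sub>R h x) - (f b - f a)) \<le> e2 * (b - a) + e3"
          using F1 F2 by (metis add_mono norm_triangle_le)
        also have "\<dots> = e * measure lborel (cbox a b)"
          using \<open>a \<le> b\<close> by (simp add: e2_def e3_def field_simps)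
        finally show ?thesis .
      qed
      ultimately show ?thesis by (intro exI[of _ d] conjI allI impI) auto
    qed
  qed
  then have "(f' has_integral (f b - f a)) (cbox a b)"
    by (rule has_integral_spike[OF negS, rotated]) (simp add: h_def)
  then show ?thesis by simp
qed

text \<open>An integrable function has its Lebesgue integral as gauge integral, so uniqueness of the
  gauge integral transfers the fundamental theorem.\<close>

lemma abs_cont_on_integral_lebesgue_on:
  fixes f :: "real \<Rightarrow> 'a::euclidean_space"
  assumes "a \<le> b" "abs_cont_on a b f"
    and "AE x in lebesgue_on {a<..<b}. (f has_vector_derivative f' x) (at x)"
    and "integrable (lebesgue_on {a<..<b}) f'"
  shows "integral\<^sup>L (lebesgue_on {a<..<b}) f' = f b - f a"
proof -
  have "(f' has_integral (f b - f a)) {a<..<b}"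
    using abs_cont_on_has_integral[OF assms(1-3)] by (simp add: has_integral_Icc_iff_Ioo)
  moreover have "(f' has_integral integral\<^sup>L (lebesgue_on {a<..<b}) f') {a<..<b}"
    by (rule has_integral_integral_lebesgue_on[OF assms(4)]) simp
  ultimately show ?thesis
    by (rule has_integral_unique[symmetric])
qed

section \<open>Integral identities and inequalities\<close>

lemma continuous_on_Icc_measurable_lebesgue_on:
  fixes h :: "real \<Rightarrow> 'a::euclidean_space"
  assumes "continuous_on {a..b} h"
  shows "h \<in> borel_measurable (lebesgue_on {a<..<b})"
proof (rule continuous_imp_measurable_on_sets_lebesgue)
  show "continuous_on {a<..<b} h"
    using assms by (rule continuous_on_subset) auto
qed simp

text \<open>A continuous factor is bounded on the compact interval. Later integrands are written as
  an integrable coefficient (\<open>1 / p\<close>, \<open>q\<close>, \<open>w\<close> or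
  \<open>g'\<close>) times a continuous factor to fit this shape.\<close>

lemma integrable_mult_continuous_on:
  fixes f h :: "real \<Rightarrow> real"
  assumes f: "integrable (lebesgue_on {a<..<b}) f" and h: "continuous_on {a..b} h"
  shows "integrable (lebesgue_on {a<..<b}) (\<lambda>x. f x * h x)"
proof -
  obtain B where "B > 0" and B: "\<And>x. x \<in> {a..b} \<Longrightarrow> norm (h x) \<le> B"
    using continuous_on_Icc_norm_bound[OF h] by blast
  have [measurable]: "h \<in> borel_measurable (lebesgue_on {a<..<b})"
    by (rule continuous_on_Icc_measurable_lebesgue_on[OF h])
  have [measurable]: "f \<in> borel_measurable (lebesgue_on {a<..<b})"
    using f by simp
  show ?thesis
  proof (rule Bochner_Integration.integrable_bound)
    show "integrable (lebesgue_on {a<..<b}) (\<lambda>x. B * f x)" using f by simp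
    show "AE x in lebesgue_on {a<..<b}. norm (f x * h x) \<le> norm (B * f x)"
    proof (rule AE_I2)
      fix x assume "x \<in> space (lebesgue_on {a<..<b})"
      then have "\<bar>h x\<bar> \<le> B" using B[of x] by simp
      then show "norm (f x * h x) \<le> norm (B * f x)"
        using mult_left_mono[of "\<bar>h x\<bar>" B "\<bar>f x\<bar>"] \<open>B > 0\<close> by (simp add: abs_mult mult.commute)
    qed
  qed measurable
qed

lemma Cauchy_Schwarz_integral:
  fixes f h :: "'a \<Rightarrow> real"
  assumes [measurable]: "f \<in> borel_measurable M" "h \<in> borel_measurable M"
    and f: "integrable M (\<lambda>x. (f x)\<^sup>2)" and h: "integrable M (\<lambda>x. (h x)\<^sup>2)"
  shows "integrable M (\<lambda>x. f x * h x)"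
    and "(LINT x|M. \<bar>f x * h x\<bar>) \<le> sqrt (LINT x|M. (f x)\<^sup>2) * sqrt (LINT x|M. (h x)\<^sup>2)"
proof -
  show int: "integrable M (\<lambda>x. f x * h x)"
  proof (rule Bochner_Integration.integrable_bound)
    show "integrable M (\<lambda>x. (f x)\<^sup>2 + (h x)\<^sup>2)" using f h by simp
    have "\<bar>u * v\<bar> \<le> u\<^sup>2 + v\<^sup>2" for u v :: real
    proof -
      have "2 * \<bar>u * v\<bar> \<le> u\<^sup>2 + v\<^sup>2"
        using sum_squares_bound[of "\<bar>u\<bar>" "\<bar>v\<bar>"] by (simp add: abs_mult mult.assoc)
      then show ?thesis using abs_ge_zero[of "u * v"] by linarith
    qed
    then show "AE x in M. norm (f x * h x) \<le> norm ((f x)\<^sup>2 + (h x)\<^sup>2)" by simp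
  qed measurable
  define A B C where "A = (LINT x|M. (f x)\<^sup>2)" and "B = (LINT x|M. (h x)\<^sup>2)"
    and "C = (LINT x|M. \<bar>f x * h x\<bar>)"
  have "A \<ge> 0" "B \<ge> 0" "C \<ge> 0" by (simp_all add: A_def B_def C_def)
  \<comment> \<open>This is the integral of
    \<open>(s * \<bar>f x\<bar> - \<bar>h x\<bar>)\<^sup>2 \<ge> 0\<close>; a good \<open>s\<close>
    is chosen afterwards.\<close>
  have quad: "2 * s * C \<le> s\<^sup>2 * A + B" for s
  proof -
    have "(LINT x|M. 2 * s * \<bar>f x * h x\<bar>) \<le> (LINT x|M. s\<^sup>2 * (f x)\<^sup>2 + (h x)\<^sup>2)"
    proof (rule integral_mono)
      fix x
      show "2 * s * \<bar>f x * h x\<bar> \<le> s\<^sup>2 * (f x)\<^sup>2 + (h x)\<^sup>2"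
        using sum_squares_bound[of "s * \<bar>f x\<bar>" "\<bar>h x\<bar>"]
        by (simp add: abs_mult mult.assoc power_mult_distrib)
    qed (use int f h in auto)
    then show ?thesis using f h by (simp add: A_def B_def C_def)
  qed
  have "C\<^sup>2 \<le> A * B"
  proof (cases "A = 0")
    case True
    \<comment> \<open>If \<open>C\<close> were positive, \<open>s = (B + 1) / C\<close> would turn
      \<open>quad\<close> into \<open>2 * (B + 1) \<le> B\<close>.\<close>
    have "C = 0"
      using quad[of "(B + 1) / C"] True \<open>C \<ge> 0\<close> \<open>B \<ge> 0\<close> by (cases "C = 0") auto
    then show ?thesis using True by simp
  next
    case False
    \<comment> \<open>The value \<open>s = C / A\<close> minimises
      \<open>s\<^sup>2 * A - 2 * s * C + B\<close>.\<close>
    then show ?thesis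
      using quad[of "C / A"] \<open>A \<ge> 0\<close> by (simp add: field_simps power2_eq_square)
  qed
  then have "C \<le> sqrt (A * B)" by (rule real_le_rsqrt)
  then show "(LINT x|M. \<bar>f x * h x\<bar>) \<le> sqrt (LINT x|M. (f x)\<^sup>2) * sqrt (LINT x|M. (h x)\<^sup>2)"
    by (simp add: A_def B_def C_def real_sqrt_mult)
qed

text \<open>Integration by parts for the system \<open>f' = u / p\<close>, \<open>u' = v f\<close>:
  the three integrands are the product-rule terms of \<open>G x * (u x \<bullet> f x)\<close>. The
  choice \<open>G = 1\<close> gives the energy identity, and \<open>G = g\<close> the identity
  without boundary terms.\<close>

lemma inner_quasi_deriv_identity:
  fixes f u :: "real \<Rightarrow> 'a::euclidean_space" and G G' p v :: "real \<Rightarrow> real"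
  assumes ab: "a \<le> b"
    and f: "abs_cont_on a b f" and u: "abs_cont_on a b u" and G: "abs_cont_on a b G"
    and df: "AE x in lebesgue_on {a<..<b}. (f has_vector_derivative (1 / p x) *\<^sub>R u x) (at x)"
    and du: "AE x in lebesgue_on {a<..<b}. (u has_vector_derivative v x *\<^sub>R f x) (at x)"
    and dG: "AE x in lebesgue_on {a<..<b}. (G has_real_derivative G' x) (at x)"
    and p: "integrable (lebesgue_on {a<..<b}) (\<lambda>x. 1 / p x)"
    and v: "integrable (lebesgue_on {a<..<b}) v"
    and G': "integrable (lebesgue_on {a<..<b}) G'"
  shows "(LINT x|lebesgue_on {a<..<b}. 1 / p x * (G x * (norm (u x))\<^sup>2))
       + (LINT x|lebesgue_on {a<..<b}. v x * (G x * (norm (f x))\<^sup>2))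
       + (LINT x|lebesgue_on {a<..<b}. G' x * (u x \<bullet> f x))
       = G b * (u b \<bullet> f b) - G a * (u a \<bullet> f a)"
proof -
  let ?M = "lebesgue_on {a<..<b}"
  note cont [continuous_intros] = abs_cont_on_imp_continuous_on[OF f]
    abs_cont_on_imp_continuous_on[OF u] abs_cont_on_imp_continuous_on[OF G]
  have int: "integrable ?M (\<lambda>x. 1 / p x * (G x * (norm (u x))\<^sup>2))"
    "integrable ?M (\<lambda>x. v x * (G x * (norm (f x))\<^sup>2))"
    "integrable ?M (\<lambda>x. G' x * (u x \<bullet> f x))"
    by (intro integrable_mult_continuous_on p v G' continuous_intros)+
  define D where "D = (\<lambda>x. 1 / p x * (G x * (norm (u x))\<^sup>2) + v x * (G x * (norm (f x))\<^sup>2)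
                          + G' x * (u x \<bullet> f x))"
  have "abs_cont_on a b (\<lambda>x. G x * (u x \<bullet> f x))"
    by (intro bounded_bilinear.abs_cont_on[OF bounded_bilinear_mult]
        bounded_bilinear.abs_cont_on[OF bounded_bilinear_inner] f u G)
  moreover have "AE x in ?M. ((\<lambda>x. G x * (u x \<bullet> f x)) has_vector_derivative D x) (at x)"
    using df du dG
  proof eventually_elim
    case (elim x)
    have "((\<lambda>x. u x \<bullet> f x) has_vector_derivative u x \<bullet> ((1 / p x) *\<^sub>R u x) + (v x *\<^sub>R f x) \<bullet> f x) (at x)"
      by (rule bounded_bilinear.has_vector_derivative[OF bounded_bilinear_inner elim(2,1)])
    from bounded_bilinear.has_vector_derivative[OF bounded_bilinear_mult
        elim(3)[unfolded has_real_derivative_iff_has_vector_derivative] this]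
    show ?case
      by (simp add: D_def dot_square_norm algebra_simps)
  qed
  moreover have "integrable ?M D" unfolding D_def using int by (intro Bochner_Integration.integrable_add)
  ultimately have "integral\<^sup>L ?M D = G b * (u b \<bullet> f b) - G a * (u a \<bullet> f a)"
    using abs_cont_on_integral_lebesgue_on[OF ab] by blast
  then show ?thesis using int by (simp add: D_def)
qed

text \<open>The derivative of \<open>f t \<bullet> f t\<close> is
  \<open>2 / p t * (f t \<bullet> u t)\<close>. Its integral between the two points is at most the
  integral of the Cauchy-Schwarz majorant \<open>k\<close> over the whole interval.\<close>

lemma norm_square_diff_le:
  fixes f u :: "real \<Rightarrow> 'a::euclidean_space"
  assumes f: "abs_cont_on a b f" and u: "abs_cont_on a b u"
    and df: "AE x in lebesgue_on {a<..<b}. (f has_vector_derivative (1 / p x) *\<^sub>R u x) (at x)"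
    and p: "integrable (lebesgue_on {a<..<b}) (\<lambda>x. 1 / p x)"
    and xy: "x \<in> {a..b}" "y \<in> {a..b}"
  shows "(norm (f x))\<^sup>2 - (norm (f y))\<^sup>2 \<le>
           2 * (LINT t|lebesgue_on {a<..<b}. \<bar>1 / p t\<bar> * (norm (f t) * norm (u t)))"
proof -
  let ?M = "lebesgue_on {a<..<b}"
  \<comment> \<open>The points are put in order; the sign of the increment is later absorbed by a
    norm.\<close>
  define c d where "c = min x y" and "d = max x y"
  have cd: "a \<le> c" "c \<le> d" "d \<le> b" using xy by (auto simp: c_def d_def)
  note cont [continuous_intros] = abs_cont_on_imp_continuous_on[OF f] abs_cont_on_imp_continuous_on[OF u]
  define h where "h = (\<lambda>t. 2 * (1 / p t * (f t \<bullet> u t)))"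
  define k where "k = (\<lambda>t. 2 * (\<bar>1 / p t\<bar> * (norm (f t) * norm (u t))))"
  have "integrable ?M k"
    unfolding k_def
    by (intro integrable_mult_right integrable_mult_continuous_on Bochner_Integration.integrable_abs
        p continuous_intros)
  then have "(k has_integral integral\<^sup>L ?M k) {a..b}"
    unfolding has_integral_Icc_iff_Ioo by (rule has_integral_integral_lebesgue_on) simp
  then have k: "k integrable_on {a..b}" "integral {a..b} k = integral\<^sup>L ?M k"
    by (auto simp: has_integral_iff)
  then have k': "k integrable_on {c..d}"
    using cd by (meson atLeastatMost_subset_iff integrable_on_subinterval)
  have "AE t in lebesgue. t \<in> {a<..<b} \<longrightarrow> (f has_vector_derivative (1 / p t) *\<^sub>R u t) (at t)"
    using df AE_restrict_space_iff[of "{a<..<b}" lebesgue] by simp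
  then have "AE t in lebesgue. t \<in> {c<..<d} \<longrightarrow> ((\<lambda>t. f t \<bullet> f t) has_vector_derivative h t) (at t)"
  proof eventually_elim
    case (elim t)
    show ?case
    proof
      assume "t \<in> {c<..<d}"
      then have d: "(f has_vector_derivative (1 / p t) *\<^sub>R u t) (at t)" using elim cd by simp
      show "((\<lambda>t. f t \<bullet> f t) has_vector_derivative h t) (at t)"
        using bounded_bilinear.has_vector_derivative[OF bounded_bilinear_inner d d]
        by (simp add: h_def inner_commute)
    qed
  qed
  then have "AE t in lebesgue_on {c<..<d}. ((\<lambda>t. f t \<bullet> f t) has_vector_derivative h t) (at t)"
    using AE_restrict_space_iff[of "{c<..<d}" lebesgue] by simp
  moreover have "abs_cont_on c d (\<lambda>t. f t \<bullet> f t)"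
    by (rule bounded_bilinear.abs_cont_on[OF bounded_bilinear_inner])
      (rule abs_cont_on_subinterval[OF f cd(1,3)])+
  \<comment> \<open>The gauge integral of \<open>h\<close> over the subinterval comes directly from
    the fundamental theorem, so no separate integrability proof is required.\<close>
  ultimately have h: "(h has_integral (f d \<bullet> f d - f c \<bullet> f c)) {c..d}"
    by (rule abs_cont_on_has_integral[OF cd(2), rotated])
  have hk: "norm (h t) \<le> k t" for t
  proof -
    have "\<bar>f t \<bullet> u t\<bar> \<le> norm (f t) * norm (u t)" by (rule Cauchy_Schwarz_ineq2)
    then have "\<bar>1 / p t\<bar> * \<bar>f t \<bullet> u t\<bar> \<le> \<bar>1 / p t\<bar> * (norm (f t) * norm (u t))"
      by (rule mult_left_mono) simp
    then show ?thesis unfolding h_def k_def real_norm_def abs_mult by simp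
  qed
  have "(norm (f x))\<^sup>2 - (norm (f y))\<^sup>2 \<le> norm (f d \<bullet> f d - f c \<bullet> f c)"
    unfolding power2_norm_eq_inner c_def d_def
    by (cases "x \<le> y") (simp_all add: min_def max_def)
  also have "\<dots> = norm (integral {c..d} h)"
    using h by (simp add: integral_unique)
  also have "\<dots> \<le> integral {c..d} k"
    by (rule Henstock_Kurzweil_Integration.integral_norm_bound_integral
        [OF has_integral_integrable[OF h] k' hk])
  \<comment> \<open>Since \<open>k\<close> is nonnegative, enlarging the interval can only increase
    its integral.\<close>
  also have "\<dots> \<le> integral {a..b} k"
  proof (rule integral_subset_le)
    show "{c..d} \<subseteq> {a..b}" using cd by simp
  qed (use k k' in \<open>simp_all add: k_def\<close>)
  also have "\<dots> = integral\<^sup>L ?M k" by (rule k(2))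
  also have "\<dots> = 2 * (LINT t|?M. \<bar>1 / p t\<bar> * (norm (f t) * norm (u t)))"
    unfolding k_def by (rule integral_mult_right_zero)
  finally show ?thesis .
qed

section \<open>Boundary conditions and eigenfunctions\<close>

text \<open>At a Robin end the quasi-derivative is a real multiple of \<open>f\<close>, and a
  Dirichlet end contributes 0. For a coupled condition, \<open>det R = 1\<close> lets the form be
  written through the values of \<open>f\<close> alone, without quasi-derivatives.\<close>

lemma boundary_form_le:
  assumes f: "f \<in> sa_domain a b p q w D" and D: "admissible D"
    and B: "norm (f a) \<le> B" "norm (f b) \<le> B"
  shows "quasi_deriv a b p f b \<bullet> f b - quasi_deriv a b p f a \<bullet> f a \<le> bc_const D * B\<^sup>2"
proof -
  have sq: "(norm (f a))\<^sup>2 \<le> B\<^sup>2" "(norm (f b))\<^sup>2 \<le> B\<^sup>2"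
    using B by (auto intro!: power_mono)
  have bound: "c * (norm (f x))\<^sup>2 \<le> \<bar>c\<bar> * B\<^sup>2" if "x = a \<or> x = b" for c :: real and x
  proof -
    have "c * (norm (f x))\<^sup>2 \<le> \<bar>c\<bar> * (norm (f x))\<^sup>2" by (intro mult_right_mono) auto
    also have "\<dots> \<le> \<bar>c\<bar> * B\<^sup>2" using that sq by (intro mult_left_mono) auto
    finally show ?thesis .
  qed
  have of_real_inner: "(of_real c * y) \<bullet> y = c * (norm y)\<^sup>2" for c :: real and y :: complex
    unfolding scaleR_conv_of_real[symmetric] by (simp add: dot_square_norm)
  show ?thesis
  proof (cases D)
    case (Separated l r)
    show ?thesis
    proof (cases l)
      case l: (Robin l')
      show ?thesis
      proof (cases r)
        case r: (Robin r')
        have "quasi_deriv a b p f a = of_real l' * f a" "quasi_deriv a b p f b = of_real r' * f b"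
          using f by (simp_all add: Separated l r)
        then show ?thesis
          using bound[of b r'] bound[of a "- l'"]
          by (simp add: Separated l r of_real_inner algebra_simps)
      next
        case r: Dirichlet
        have "quasi_deriv a b p f a = of_real l' * f a" "f b = 0"
          using f by (simp_all add: Separated l r)
        then show ?thesis
          using bound[of a "- l'"] by (simp add: Separated l r of_real_inner)
      qed
    next
      case l: Dirichlet
      show ?thesis
      proof (cases r)
        case r: (Robin r')
        have "f a = 0" "quasi_deriv a b p f b = of_real r' * f b"
          using f by (simp_all add: Separated l r)
        then show ?thesis
          using bound[of b r'] by (simp add: Separated l r of_real_inner)
      next
        case r: Dirichlet
        have "f a = 0" "f b = 0" using f by (simp_all add: Separated l r)
        then show ?thesis by (simp add: Separated l r)
      qed
    qed
  next
    case (Coupled \<phi> R)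
    define r11 r12 r21 r22 where "r11 = R$1$1" and "r12 = R$1$2" and "r21 = R$2$1" and "r22 = R$2$2"
    note r = r11_def r12_def r21_def r22_def
    have det: "r11 * r22 - r12 * r21 = 1" using D by (simp add: Coupled det_2 r)
    define x X where "x = f a" and "X = quasi_deriv a b p f a"
    define z Z where "z = r11 *\<^sub>R x + r12 *\<^sub>R X" and "Z = r21 *\<^sub>R x + r22 *\<^sub>R X"
    have fb: "f b = cis \<phi> * z" "quasi_deriv a b p f b = cis \<phi> * Z"
      using f by (simp_all add: Coupled r x_def X_def z_def Z_def scaleR_conv_of_real)
    \<comment> \<open>Multiplication by \<open>cis \<phi>\<close> is an isometry of the plane, so
      the phase drops out of the boundary form.\<close>
    have rot: "(cis \<phi> * s) \<bullet> (cis \<phi> * t) = s \<bullet> t" for s t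
    proof -
      have "(cos \<phi>)\<^sup>2 = 1 - (sin \<phi>)\<^sup>2" by (simp add: cos_squared_eq)
      then show ?thesis by (simp add: inner_complex_def) algebra
    qed
    have norm_z: "norm z \<le> B" using B(2) by (simp add: fb norm_mult)
    let ?L = "quasi_deriv a b p f b \<bullet> f b - quasi_deriv a b p f a \<bullet> f a"
    have L: "?L = Z \<bullet> z - X \<bullet> x" by (simp add: fb rot x_def X_def)
    define P Q S where "P = x \<bullet> x" and "Q = x \<bullet> X" and "S = X \<bullet> X"
    have Zz: "Z \<bullet> z - X \<bullet> x = r11 * r21 * P + (r11 * r22 + r12 * r21 - 1) * Q + r12 * r22 * S"
      by (simp add: z_def Z_def P_def Q_def S_def inner_simps inner_commute[of X x] algebra_simps)
    show ?thesis
    proof (cases "r12 = 0")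
      case True
      \<comment> \<open>With \<open>r12 = 0\<close> the determinant condition reads
        \<open>r11 * r22 = 1\<close>, which cancels the coefficient of \<open>Q\<close>; that of
        \<open>S\<close> is 0.\<close>
      have "?L = r11 * r21 * (norm (f a))\<^sup>2"
        using Zz det True by (simp add: L P_def x_def dot_square_norm)
      then show ?thesis
        using bound[of a "r11 * r21"] True by (simp add: Coupled r)
    next
      case False
      have zz: "z \<bullet> z = r11\<^sup>2 * P + 2 * r11 * r12 * Q + r12\<^sup>2 * S"
        by (simp add: z_def P_def Q_def S_def inner_simps inner_commute[of X x] algebra_simps power2_eq_square)
      have zx: "z \<bullet> x = r11 * P + r12 * Q"
        by (simp add: z_def P_def Q_def inner_simps inner_commute[of X x])
      \<comment> \<open>From \<open>r12 *\<^sub>R X = z - r11 *\<^sub>R x\<close> and the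
        determinant condition follows \<open>r12 *\<^sub>R Z = r22 *\<^sub>R z - x\<close>. Both
        quasi-derivatives are thereby eliminated.\<close>
      have id: "r12 * ?L = r22 * (z \<bullet> z) + r11 * P - 2 * (z \<bullet> x)"
        unfolding L Zz zz zx using det by algebra
      have n: "z \<bullet> z \<le> B\<^sup>2" "P \<le> B\<^sup>2" "0 \<le> z \<bullet> z" "0 \<le> P" "\<bar>z \<bullet> x\<bar> \<le> B\<^sup>2"
      proof -
        show "z \<bullet> z \<le> B\<^sup>2" using norm_z by (simp add: dot_square_norm power_mono)
        show "P \<le> B\<^sup>2" using sq by (simp add: P_def x_def dot_square_norm)
        have "\<bar>z \<bullet> x\<bar> \<le> norm z * norm x" by (rule Cauchy_Schwarz_ineq2)
        also have "\<dots> \<le> B * B"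
          using norm_z B(1) order_trans[OF norm_ge_zero B(1)] by (intro mult_mono) (auto simp: x_def)
        finally show "\<bar>z \<bullet> x\<bar> \<le> B\<^sup>2" by (simp add: power2_eq_square)
      qed (simp_all add: P_def)
      have "\<bar>r12\<bar> * ?L \<le> \<bar>r12 * ?L\<bar>" by (simp add: abs_mult mult_left_mono)
      also have "\<dots> \<le> \<bar>r22 * (z \<bullet> z)\<bar> + \<bar>r11 * P\<bar> + 2 * \<bar>z \<bullet> x\<bar>"
        unfolding id by linarith
      also have "\<dots> \<le> \<bar>r22\<bar> * B\<^sup>2 + \<bar>r11\<bar> * B\<^sup>2 + 2 * B\<^sup>2"
        using n by (intro add_mono) (auto simp: abs_mult intro!: mult_left_mono)
      finally have "?L * \<bar>r12\<bar> \<le> (\<bar>r11\<bar> + \<bar>r22\<bar> + 2) * B\<^sup>2"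
        by (simp add: algebra_simps)
      then have "?L \<le> (\<bar>r11\<bar> + \<bar>r22\<bar> + 2) * B\<^sup>2 / \<bar>r12\<bar>"
        by (subst pos_le_divide_eq) (use False in simp_all)
      then show ?thesis using False by (simp add: Coupled r)
    qed
  qed
qed

text \<open>Puts the eigenvalue equation into the form of a first-order system for the function and
  its quasi-derivative, which is what the analytic lemmas assume.\<close>

lemma is_eigenfunctionD:
  assumes \<phi>: "is_eigenfunction a b p q w D (of_real lam) \<phi>"
    and pos: "AE x in lebesgue_on {a<..<b}. p x > 0"
  defines "u \<equiv> quasi_deriv a b p \<phi>"
  shows "abs_cont_on a b \<phi>" "abs_cont_on a b u" "\<phi> \<in> sa_domain a b p q w D"
    and "AE x in lebesgue_on {a<..<b}. (\<phi> has_vector_derivative (1 / p x) *\<^sub>R u x) (at x)"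
    and "AE x in lebesgue_on {a<..<b}. (u has_vector_derivative (q x - lam * w x) *\<^sub>R \<phi> x) (at x)"
proof -
  show sa: "\<phi> \<in> sa_domain a b p q w D" using \<phi> by (simp add: is_eigenfunction_def)
  then have dom: "\<phi> \<in> D_max a b p q w" by (cases D) auto
  then show "abs_cont_on a b \<phi>" by (simp add: D_max_def)
  have "\<exists>u. is_quasi_deriv a b p \<phi> u" using dom by (simp add: D_max_def)
  then have u: "is_quasi_deriv a b p \<phi> u" unfolding u_def quasi_deriv_def by (rule someI_ex)
  then show "abs_cont_on a b u" by (simp add: is_quasi_deriv_def)
  have "AE x in lebesgue_on {a<..<b}. \<exists>d. (\<phi> has_vector_derivative d) (at x) \<and> u x = of_real (p x) * d"
    using u by (simp add: is_quasi_deriv_def)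
  then show "AE x in lebesgue_on {a<..<b}. (\<phi> has_vector_derivative (1 / p x) *\<^sub>R u x) (at x)"
    using pos
  proof eventually_elim
    case (elim x)
    then obtain d where d: "(\<phi> has_vector_derivative d) (at x)" "u x = of_real (p x) * d" by blast
    have "(1 / p x) *\<^sub>R u x = d"
      using elim(2) by (simp add: d(2) scaleR_conv_of_real)
    then show ?case using d(1) by simp
  qed
  have "AE x in lebesgue_on {a<..<b}. u differentiable (at x)"
    using dom by (simp add: D_max_def u_def)
  moreover have "AE x in lebesgue_on {a<..<b}. - vector_derivative u (at x) + of_real (q x) * \<phi> x
          = of_real lam * of_real (w x) * \<phi> x"
    using \<phi> by (simp add: is_eigenfunction_def u_def)
  ultimately show "AE x in lebesgue_on {a<..<b}. (u has_vector_derivative (q x - lam * w x) *\<^sub>R \<phi> x) (at x)"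
  proof eventually_elim
    case (elim x)
    have "vector_derivative u (at x) = (q x - lam * w x) *\<^sub>R \<phi> x"
      using elim(2) by (simp add: scaleR_conv_of_real algebra_simps add_eq_0_iff eq_neg_iff_add_eq_0)
    then show ?case using elim(1) by (simp add: vector_derivative_works)
  qed
qed

section \<open>Bounds of an eigenfunction and its quasi-derivative by the weighted norm\<close>

text \<open>Squaring \<open>\<beta> - \<alpha>\<close> gives \<open>\<beta>\<^sup>2 = \<alpha> * (2
  * \<beta> + 1 / P) = \<alpha> * \<gamma>\<^sup>2\<close>, hence
  \<open>\<beta> = sqrt \<alpha> * \<gamma>\<close>. Combined with
  \<open>\<beta> \<ge> \<alpha>\<close> this yields the last inequality after cancelling
  \<open>sqrt \<alpha>\<close>.\<close>

lemma sobolev_constants: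
  fixes \<alpha> \<beta> \<gamma> P :: real
  assumes "\<alpha> \<ge> 0" "P > 0"
    and \<beta>: "\<beta> = sqrt (\<alpha> * (1 / P + \<alpha>)) + \<alpha>" and \<gamma>: "\<gamma> = sqrt (2 * \<beta> + 1 / P)"
  shows "\<beta> \<ge> 0" "\<gamma> > 0" "\<gamma>\<^sup>2 = 2 * \<beta> + 1 / P" "\<beta> = sqrt \<alpha> * \<gamma>" "\<gamma> \<ge> sqrt \<alpha>"
proof -
  have rad: "\<alpha> * (1 / P + \<alpha>) \<ge> 0" using assms(1,2) by simp
  have "\<beta> \<ge> \<alpha>" unfolding \<beta> using rad by simp
  then show b0: "\<beta> \<ge> 0" using assms(1) by simp
  have "2 * \<beta> + 1 / P > 0" using b0 assms(2) by (simp add: add_nonneg_pos)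
  then show g0: "\<gamma> > 0" and g2: "\<gamma>\<^sup>2 = 2 * \<beta> + 1 / P" by (simp_all add: \<gamma>)
  have "(\<beta> - \<alpha>)\<^sup>2 = \<alpha> * (1 / P + \<alpha>)" using rad by (simp add: \<beta>)
  then have "\<beta>\<^sup>2 = \<alpha> * \<gamma>\<^sup>2" unfolding g2 by (simp add: power2_eq_square algebra_simps)
  then have "\<beta> = sqrt (\<alpha> * \<gamma>\<^sup>2)" using b0 by (metis real_sqrt_abs abs_of_nonneg)
  then show bg: "\<beta> = sqrt \<alpha> * \<gamma>" using g0 by (simp add: real_sqrt_mult)
  have "sqrt \<alpha> * sqrt \<alpha> \<le> sqrt \<alpha> * \<gamma>" using \<open>\<beta> \<ge> \<alpha>\<close> assms(1) by (simp add: bg[symmetric])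
  then have "\<alpha> \<noteq> 0 \<Longrightarrow> \<gamma> \<ge> sqrt \<alpha>"
    by (rule mult_left_le_imp_le) (use assms(1) in simp)
  then show "\<gamma> \<ge> sqrt \<alpha>"
    using g0 by (cases "\<alpha> = 0") simp_all
qed

text \<open>With \<open>s = sqrt \<alpha>\<close> the hypotheses give
  \<open>M\<^sup>2 - 2 * s * N * M - N\<^sup>2 / P \<le> 0\<close>. This quadratic in
  \<open>M\<close> has the root \<open>\<gamma> * N\<close> and factors accordingly. If
  \<open>M > \<gamma> * N\<close>, the other factor exceeds
  \<open>2 * (\<gamma> - s) * N \<ge> 0\<close>, which is impossible.\<close>

lemma sobolev_sup_bound:
  fixes \<alpha> \<beta> \<gamma> P M N K :: real
  assumes "\<alpha> \<ge> 0" "P > 0" "M \<ge> 0" "N \<ge> 0"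
    and \<beta>: "\<beta> = sqrt (\<alpha> * (1 / P + \<alpha>)) + \<alpha>" and \<gamma>: "\<gamma> = sqrt (2 * \<beta> + 1 / P)"
    and K: "K \<le> sqrt \<alpha> * M" and M: "M\<^sup>2 * P - N\<^sup>2 \<le> 2 * K * N * P"
  shows "M \<le> \<gamma> * N" "K \<le> \<beta> * N"
proof -
  note c = sobolev_constants[OF assms(1,2) \<beta> \<gamma>]
  define s where "s = sqrt \<alpha>"
  have "s \<ge> 0" "s \<le> \<gamma>" "\<beta> = s * \<gamma>" using c assms(1) by (simp_all add: s_def)
  have "M\<^sup>2 - N\<^sup>2 / P \<le> 2 * K * N" using M assms(2) by (simp add: field_simps)
  also have "\<dots> \<le> 2 * (s * M) * N" using K assms(4) by (intro mult_right_mono mult_left_mono) (auto simp: s_def)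
  finally have q: "M\<^sup>2 - N\<^sup>2 / P \<le> 2 * s * M * N" by simp
  have g2: "\<gamma>\<^sup>2 = 2 * (s * \<gamma>) + 1 / P" using c(3) \<open>\<beta> = s * \<gamma>\<close> by simp
  have fact: "(M - \<gamma> * N) * (M + \<gamma> * N - 2 * s * N) \<le> 0"
  proof -
    have "(M - \<gamma> * N) * (M + \<gamma> * N - 2 * s * N)
        = M\<^sup>2 - (\<gamma>\<^sup>2 - 2 * (s * \<gamma>)) * N\<^sup>2 - 2 * s * M * N"
      by (simp add: power2_eq_square algebra_simps)
    also have "\<dots> = M\<^sup>2 - N\<^sup>2 / P - 2 * s * M * N" by (simp add: g2)
    finally show ?thesis using q by simp
  qed
  show "M \<le> \<gamma> * N"
  proof (rule ccontr)
    assume "\<not> M \<le> \<gamma> * N"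
    then have "M - \<gamma> * N > 0" by simp
    moreover have "s * N \<le> \<gamma> * N" using \<open>s \<le> \<gamma>\<close> assms(4) by (rule mult_right_mono)
    ultimately have "M + \<gamma> * N - 2 * s * N > 0" by simp
    with \<open>M - \<gamma> * N > 0\<close> have "(M - \<gamma> * N) * (M + \<gamma> * N - 2 * s * N) > 0" by (rule mult_pos_pos)
    with fact show False by simp
  qed
  then have "s * M \<le> s * (\<gamma> * N)" using \<open>s \<ge> 0\<close> by (rule mult_left_mono)
  then show "K \<le> \<beta> * N" using K \<open>\<beta> = s * \<gamma>\<close> by (simp add: s_def mult.assoc)
qed

lemma norm_L1_nonneg: "norm_L1 a b f \<ge> 0"
  unfolding norm_L1_def by (rule Bochner_Integration.integral_nonneg) (rule abs_ge_zero)

text \<open>In the energy identity the sign condition disposes of the term with \<open>lam\<close>,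
  the boundary form is at most \<open>c * B\<^sup>2\<close>, and only the negative part of
  \<open>q\<close> can increase the energy.\<close>

lemma eigenfunction_energy_le:
  fixes f u :: "real \<Rightarrow> 'a::euclidean_space"
  assumes ab: "a \<le> b"
    and f: "abs_cont_on a b f" and u: "abs_cont_on a b u"
    and df: "AE x in lebesgue_on {a<..<b}. (f has_vector_derivative (1 / p x) *\<^sub>R u x) (at x)"
    and du: "AE x in lebesgue_on {a<..<b}. (u has_vector_derivative (q x - lam * w x) *\<^sub>R f x) (at x)"
    and p: "integrable (lebesgue_on {a<..<b}) (\<lambda>x. 1 / p x)"
    and q: "integrable (lebesgue_on {a<..<b}) q"
    and w: "integrable (lebesgue_on {a<..<b}) w"
    and B: "\<And>x. x \<in> {a..b} \<Longrightarrow> norm (f x) \<le> B"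
    and bc: "u b \<bullet> f b - u a \<bullet> f a \<le> c * B\<^sup>2"
    and sgn: "lam * (LINT x|lebesgue_on {a<..<b}. (norm (f x))\<^sup>2 * w x) \<le> 0"
  shows "(LINT x|lebesgue_on {a<..<b}. 1 / p x * (norm (u x))\<^sup>2)
           \<le> (c + norm_L1 a b (\<lambda>x. min 0 (q x))) * B\<^sup>2"
proof -
  let ?M = "lebesgue_on {a<..<b}"
  note cont [continuous_intros] = abs_cont_on_imp_continuous_on[OF f] abs_cont_on_imp_continuous_on[OF u]
  have int: "integrable ?M (\<lambda>x. q x * (norm (f x))\<^sup>2)" "integrable ?M (\<lambda>x. w x * (norm (f x))\<^sup>2)"
    by (intro integrable_mult_continuous_on q w continuous_intros)+
  have [measurable]: "q \<in> borel_measurable ?M" using q by simp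
  have qm: "integrable ?M (\<lambda>x. \<bar>min 0 (q x)\<bar>)"
    by (rule Bochner_Integration.integrable_bound[OF q]) auto
  \<comment> \<open>The weight is the constant 1, so the integral containing its derivative
    vanishes.\<close>
  have "(LINT x|?M. 1 / p x * (norm (u x))\<^sup>2)
        + (LINT x|?M. (q x - lam * w x) * (norm (f x))\<^sup>2) = u b \<bullet> f b - u a \<bullet> f a"
    using inner_quasi_deriv_identity[OF ab f u abs_cont_on_const[of a b "1::real"] df du, of "\<lambda>_. 0"] p q w
    by simp
  moreover have "(LINT x|?M. (q x - lam * w x) * (norm (f x))\<^sup>2)
        = (LINT x|?M. q x * (norm (f x))\<^sup>2) - lam * (LINT x|?M. (norm (f x))\<^sup>2 * w x)"
  proof -
    have "(\<lambda>x. (q x - lam * w x) * (norm (f x))\<^sup>2) = (\<lambda>x. q x * (norm (f x))\<^sup>2 - lam * (w x * (norm (f x))\<^sup>2))"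
      by (simp add: algebra_simps)
    then show ?thesis using int by (simp add: mult.commute[of "w _"])
  qed
  moreover have "- (LINT x|?M. q x * (norm (f x))\<^sup>2) \<le> norm_L1 a b (\<lambda>x. min 0 (q x)) * B\<^sup>2"
  proof -
    have "(LINT x|?M. - (q x * (norm (f x))\<^sup>2)) \<le> (LINT x|?M. \<bar>min 0 (q x)\<bar> * B\<^sup>2)"
    proof (rule integral_mono)
      fix x assume "x \<in> space ?M"
      then have fB: "(norm (f x))\<^sup>2 \<le> B\<^sup>2" using B[of x] by (simp add: power_mono)
      have "- (q x * (norm (f x))\<^sup>2) \<le> \<bar>min 0 (q x)\<bar> * (norm (f x))\<^sup>2"
        using mult_right_mono[of "- q x" "\<bar>min 0 (q x)\<bar>" "(norm (f x))\<^sup>2"] by simp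
      also have "\<dots> \<le> \<bar>min 0 (q x)\<bar> * B\<^sup>2" using fB by (rule mult_left_mono) simp
      finally show "- (q x * (norm (f x))\<^sup>2) \<le> \<bar>min 0 (q x)\<bar> * B\<^sup>2" .
    qed (use int qm in simp_all)
    then show ?thesis by (simp add: norm_L1_def)
  qed
  ultimately show ?thesis using bc sgn by (simp add: distrib_right)
qed

text \<open>Applied with the attained maximum \<open>B\<close> of \<open>norm (f x)\<close>: the
  energy estimate bounds \<open>K\<close> by \<open>sqrt \<alpha> * B\<close>, and averaging the
  oscillation of the squared norm bounds \<open>B\<close> through \<open>N\<close> and
  \<open>K\<close>. The pair is then resolved by \<open>sobolev_sup_bound\<close>.\<close>

lemma eigenfunction_bounds:
  fixes f u :: "real \<Rightarrow> 'a::euclidean_space" and \<alpha> \<beta> \<gamma> :: real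
  assumes ab: "a < b"
    and f: "abs_cont_on a b f" and u: "abs_cont_on a b u"
    and df: "AE x in lebesgue_on {a<..<b}. (f has_vector_derivative (1 / p x) *\<^sub>R u x) (at x)"
    and du: "AE x in lebesgue_on {a<..<b}. (u has_vector_derivative (q x - lam * w x) *\<^sub>R f x) (at x)"
    and p: "integrable (lebesgue_on {a<..<b}) (\<lambda>x. 1 / p x)"
    and pos: "AE x in lebesgue_on {a<..<b}. p x > 0"
    and pm: "p \<in> borel_measurable (lebesgue_on {a<..<b})"
    and P: "norm_L1 a b (\<lambda>x. 1 / p x) > 0"
    and q: "integrable (lebesgue_on {a<..<b}) q"
    and w: "integrable (lebesgue_on {a<..<b}) w"
    and bc: "\<And>B. norm (f a) \<le> B \<Longrightarrow> norm (f b) \<le> B \<Longrightarrow> u b \<bullet> f b - u a \<bullet> f a \<le> c * B\<^sup>2"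
    and "c \<ge> 0"
    and sgn: "lam * (LINT x|lebesgue_on {a<..<b}. (norm (f x))\<^sup>2 * w x) \<le> 0"
    and \<alpha>: "\<alpha> = c + norm_L1 a b (\<lambda>x. min 0 (q x))"
    and \<beta>: "\<beta> = sqrt (\<alpha> * (1 / norm_L1 a b (\<lambda>x. 1 / p x) + \<alpha>)) + \<alpha>"
    and \<gamma>: "\<gamma> = sqrt (2 * \<beta> + 1 / norm_L1 a b (\<lambda>x. 1 / p x))"
  defines "N \<equiv> sqrt (LINT x|lebesgue_on {a<..<b}. 1 / p x * (norm (f x))\<^sup>2)"
    and "K \<equiv> sqrt (LINT x|lebesgue_on {a<..<b}. 1 / p x * (norm (u x))\<^sup>2)"
  shows "\<And>x. x \<in> {a..b} \<Longrightarrow> norm (f x) \<le> \<gamma> * N" and "K \<le> \<beta> * N"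
proof -
  let ?M = "lebesgue_on {a<..<b}"
  let ?P = "norm_L1 a b (\<lambda>x. 1 / p x)"
  note cont [continuous_intros] = abs_cont_on_imp_continuous_on[OF f] abs_cont_on_imp_continuous_on[OF u]
  obtain x0 where x0: "x0 \<in> {a..b}" and max: "\<And>x. x \<in> {a..b} \<Longrightarrow> norm (f x) \<le> norm (f x0)"
  proof -
    have "continuous_on {a..b} (\<lambda>x. norm (f x))" by (intro continuous_intros)
    then show ?thesis
      using continuous_attains_sup[of "{a..b}" "\<lambda>x. norm (f x)"] ab that by auto
  qed
  define B where "B = norm (f x0)"
  have "\<alpha> \<ge> 0" using \<open>c \<ge> 0\<close> by (simp add: \<alpha> norm_L1_nonneg)
  have "(LINT x|?M. 1 / p x * (norm (u x))\<^sup>2) \<le> \<alpha> * B\<^sup>2"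
    unfolding \<alpha> B_def
    using eigenfunction_energy_le[OF less_imp_le[OF ab] f u df du p q w max bc sgn] max ab by simp
  then have K: "K \<le> sqrt \<alpha> * B"
    unfolding K_def using real_sqrt_le_mono real_sqrt_mult[of \<alpha> "B\<^sup>2"] by (fastforce simp: B_def)
  have [measurable]: "p \<in> borel_measurable ?M" "f \<in> borel_measurable ?M" "u \<in> borel_measurable ?M"
    by (fact pm, rule continuous_on_Icc_measurable_lebesgue_on[OF cont(1)],
        rule continuous_on_Icc_measurable_lebesgue_on[OF cont(2)])
  have int: "integrable ?M (\<lambda>x. 1 / p x * (norm (f x))\<^sup>2)" "integrable ?M (\<lambda>x. 1 / p x * (norm (u x))\<^sup>2)"
    by (intro integrable_mult_continuous_on p continuous_intros)+
  have N0: "(LINT x|?M. 1 / p x * (norm (f x))\<^sup>2) \<ge> 0" "(LINT x|?M. 1 / p x * (norm (u x))\<^sup>2) \<ge> 0"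
    using pos by (auto intro!: integral_nonneg_AE elim!: eventually_mono)
  have CS: "(LINT x|?M. \<bar>1 / p x\<bar> * (norm (f x) * norm (u x))) \<le> N * K"
  proof -
    \<comment> \<open>The weight \<open>1 / p\<close> is shared as a square root between the two
      factors of Cauchy-Schwarz. All rewriting of the roots is a.e. because \<open>p\<close> is
      positive only a.e.\<close>
    let ?h = "\<lambda>g x. sqrt (1 / p x) * norm (g x :: 'a)"
    have sq: "AE x in ?M. (?h g x)\<^sup>2 = 1 / p x * (norm (g x))\<^sup>2" for g
      using pos by eventually_elim (simp add: power_mult_distrib)
    have sqi: "integrable ?M (\<lambda>x. (?h f x)\<^sup>2)" "integrable ?M (\<lambda>x. (?h u x)\<^sup>2)"
      using int by (subst integrable_cong_AE[OF _ _ sq]; simp)+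
    have sqe: "(LINT x|?M. (?h f x)\<^sup>2) = N\<^sup>2" "(LINT x|?M. (?h u x)\<^sup>2) = K\<^sup>2"
      using N0 by (subst integral_cong_AE[OF _ _ sq]; simp add: N_def K_def)+
    have "(LINT x|?M. \<bar>?h f x * ?h u x\<bar>) \<le> sqrt (N\<^sup>2) * sqrt (K\<^sup>2)"
      using Cauchy_Schwarz_integral(2)[OF _ _ sqi] unfolding sqe by simp
    also have "\<dots> = N * K" using N0 by (simp add: N_def K_def)
    also have "(LINT x|?M. \<bar>?h f x * ?h u x\<bar>) = (LINT x|?M. \<bar>1 / p x\<bar> * (norm (f x) * norm (u x)))"
    proof (rule integral_cong_AE)
      show "AE x in ?M. \<bar>?h f x * ?h u x\<bar> = \<bar>1 / p x\<bar> * (norm (f x) * norm (u x))"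
        using pos
      proof eventually_elim
        case (elim x)
        have "?h f x * ?h u x = (sqrt (1 / p x) * sqrt (1 / p x)) * (norm (f x) * norm (u x))"
          by (simp only: ac_simps)
        also have "sqrt (1 / p x) * sqrt (1 / p x) = 1 / p x" using elim by simp
        finally show ?case using elim by (simp add: abs_mult)
      qed
    qed measurable
    finally show ?thesis .
  qed
  have osc: "B\<^sup>2 - (norm (f y))\<^sup>2 \<le> 2 * (N * K)" if "y \<in> {a..b}" for y
    using norm_square_diff_le[OF f u df p x0 that] CS by (simp add: B_def)
  \<comment> \<open>The oscillation bound from the maximum point is multiplied by
    \<open>1 / p y\<close> and integrated in \<open>y\<close>; its constant side picks up the factor
    \<open>?P\<close>.\<close>
  have "AE y in ?M. 1 / p y * (B\<^sup>2 - 2 * (N * K)) \<le> 1 / p y * (norm (f y))\<^sup>2"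
    using pos AE_space
  proof eventually_elim
    case (elim y)
    then have "B\<^sup>2 - 2 * (N * K) \<le> (norm (f y))\<^sup>2"
      using osc[of y] by simp
    then show ?case using elim by (intro mult_left_mono) simp_all
  qed
  then have "(LINT y|?M. 1 / p y * (B\<^sup>2 - 2 * (N * K))) \<le> (LINT y|?M. 1 / p y * (norm (f y))\<^sup>2)"
    by (intro integral_mono_AE integrable_mult_left p int)
  also have "\<dots> = N\<^sup>2" using N0 by (simp add: N_def)
  also have "(LINT y|?M. 1 / p y * (B\<^sup>2 - 2 * (N * K))) = ?P * (B\<^sup>2 - 2 * (N * K))"
  proof -
    have "(LINT y|?M. 1 / p y) = ?P"
      unfolding norm_L1_def using pos by (intro integral_cong_AE) (auto elim!: eventually_mono)
    then show ?thesis using integral_mult_left_zero[of ?M "\<lambda>y. 1 / p y" "B\<^sup>2 - 2 * (N * K)"] by simp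
  qed
  finally have M: "B\<^sup>2 * ?P - N\<^sup>2 \<le> 2 * K * N * ?P" by (simp add: algebra_simps)
  have "N \<ge> 0" "B \<ge> 0" using N0 by (simp_all add: N_def B_def)
  note bounds = sobolev_sup_bound[OF \<open>\<alpha> \<ge> 0\<close> P this(2,1) \<beta> \<gamma> K M]
  show "K \<le> \<beta> * N" by (rule bounds(2))
  show "norm (f x) \<le> \<gamma> * N" if "x \<in> {a..b}" for x
    using max[OF that] bounds(1) by (simp add: B_def)
qed

section \<open>The weight function g\<close>

lemma integral_norm_bound_AE:
  fixes f :: "'a \<Rightarrow> 'b::{banach, second_countable_topology}"
  assumes "integrable M f" "integrable M h" "AE x in M. norm (f x) \<le> h x"
  shows "norm (integral\<^sup>L M f) \<le> integral\<^sup>L M h"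
proof -
  have "norm (integral\<^sup>L M f) \<le> (LINT x|M. norm (f x))" by (rule integral_norm_bound)
  also have "\<dots> \<le> integral\<^sup>L M h" using assms by (intro integral_mono_AE) simp_all
  finally show ?thesis .
qed

text \<open>Testing with \<open>g f\<close> leaves no boundary terms, since \<open>g\<close>
  vanishes at both ends. The term with \<open>lam\<close> is then a sum of three integrals: those of
  \<open>g \<bar>u\<bar>\<^sup>2 / p\<close> and \<open>q g \<bar>f\<bar>\<^sup>2\<close> are
  bounded through \<open>L\<close>, and that of \<open>g' (u \<bullet> f)\<close> by
  Cauchy-Schwarz.\<close>

lemma weighted_eigenvalue_le:
  fixes f u :: "real \<Rightarrow> 'a::euclidean_space" and g g' :: "real \<Rightarrow> real"
  assumes ab: "a \<le> b"
    and f: "abs_cont_on a b f" and u: "abs_cont_on a b u" and g: "abs_cont_on a b g"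
    and df: "AE x in lebesgue_on {a<..<b}. (f has_vector_derivative (1 / p x) *\<^sub>R u x) (at x)"
    and du: "AE x in lebesgue_on {a<..<b}. (u has_vector_derivative (q x - lam * w x) *\<^sub>R f x) (at x)"
    and dg: "AE x in lebesgue_on {a<..<b}. (g has_real_derivative g' x) (at x)"
    and p: "integrable (lebesgue_on {a<..<b}) (\<lambda>x. 1 / p x)"
    and pos: "AE x in lebesgue_on {a<..<b}. p x > 0"
    and pm: "p \<in> borel_measurable (lebesgue_on {a<..<b})"
    and q: "integrable (lebesgue_on {a<..<b}) q"
    and w: "integrable (lebesgue_on {a<..<b}) w"
    and g'm: "g' \<in> borel_measurable (lebesgue_on {a<..<b})"
    and g'2: "integrable (lebesgue_on {a<..<b}) (\<lambda>x. p x * (g' x)\<^sup>2)"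
    and g0: "g a = 0" "g b = 0"
    and L: "AE x in lebesgue_on {a<..<b}. \<bar>g x\<bar> \<le> L" and "L \<ge> 0"
    and B: "\<And>x. x \<in> {a..b} \<Longrightarrow> norm (f x) \<le> B"
  defines "K \<equiv> sqrt (LINT x|lebesgue_on {a<..<b}. 1 / p x * (norm (u x))\<^sup>2)"
    and "F \<equiv> sqrt (LINT x|lebesgue_on {a<..<b}. p x * (g' x)\<^sup>2)"
  shows "\<bar>lam * (LINT x|lebesgue_on {a<..<b}. w x * (g x * (norm (f x))\<^sup>2))\<bar>
           \<le> B * (F * K) + L * (K\<^sup>2 + norm_L1 a b q * B\<^sup>2)"
proof -
  let ?M = "lebesgue_on {a<..<b}"
  have "B \<ge> 0" using B[of a] ab order_trans[OF norm_ge_zero] by simp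
  note cont [continuous_intros] = abs_cont_on_imp_continuous_on[OF f]
    abs_cont_on_imp_continuous_on[OF u] abs_cont_on_imp_continuous_on[OF g]
  have [measurable]: "p \<in> borel_measurable ?M" "g' \<in> borel_measurable ?M" "u \<in> borel_measurable ?M"
    by (fact pm, fact g'm, rule continuous_on_Icc_measurable_lebesgue_on[OF cont(2)])
  \<comment> \<open>The splitting \<open>g' = (sqrt p g') * sqrt (1 / p)\<close> into two
    square-integrable factors makes \<open>g'\<close> integrable, as the integral identity
    demands.\<close>
  let ?h = "\<lambda>x. sqrt (p x) * g' x"
  have h2: "AE x in ?M. (?h x)\<^sup>2 = p x * (g' x)\<^sup>2"
    using pos by eventually_elim (simp add: power_mult_distrib)
  have h2i: "integrable ?M (\<lambda>x. (?h x)\<^sup>2)"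
    using g'2 by (subst integrable_cong_AE[OF _ _ h2]; simp)
  have r2: "AE x in ?M. (sqrt (1 / p x))\<^sup>2 = 1 / p x"
    using pos by eventually_elim simp
  have r2i: "integrable ?M (\<lambda>x. (sqrt (1 / p x))\<^sup>2)"
    using p by (subst integrable_cong_AE[OF _ _ r2]; simp)
  have cancel: "AE x in ?M. ?h x * sqrt (1 / p x) = g' x"
    using pos by eventually_elim (simp add: real_sqrt_divide)
  have "integrable ?M (\<lambda>x. ?h x * sqrt (1 / p x))"
    by (rule Cauchy_Schwarz_integral(1)[OF _ _ h2i r2i]) measurable
  then have g'i: "integrable ?M g'"
    by (subst (asm) integrable_cong_AE[OF _ _ cancel]; simp)
  have int: "integrable ?M (\<lambda>x. 1 / p x * (g x * (norm (u x))\<^sup>2))"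
    "integrable ?M (\<lambda>x. 1 / p x * (norm (u x))\<^sup>2)"
    "integrable ?M (\<lambda>x. q x * (g x * (norm (f x))\<^sup>2))"
    "integrable ?M (\<lambda>x. w x * (g x * (norm (f x))\<^sup>2))"
    "integrable ?M (\<lambda>x. g' x * (u x \<bullet> f x))"
    "integrable ?M (\<lambda>x. g' x * norm (u x))"
    by (intro integrable_mult_continuous_on p q w g'i continuous_intros)+
  have K0: "(LINT x|?M. 1 / p x * (norm (u x))\<^sup>2) \<ge> 0" and F0: "(LINT x|?M. p x * (g' x)\<^sup>2) \<ge> 0"
    using pos by (auto intro!: integral_nonneg_AE elim!: eventually_mono)
  have id: "(LINT x|?M. 1 / p x * (g x * (norm (u x))\<^sup>2))
        + (LINT x|?M. (q x - lam * w x) * (g x * (norm (f x))\<^sup>2))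
        + (LINT x|?M. g' x * (u x \<bullet> f x)) = 0"
    using inner_quasi_deriv_identity[OF ab f u g df du dg p _ g'i] q w g0 by simp
  have split: "(LINT x|?M. (q x - lam * w x) * (g x * (norm (f x))\<^sup>2))
        = (LINT x|?M. q x * (g x * (norm (f x))\<^sup>2)) - lam * (LINT x|?M. w x * (g x * (norm (f x))\<^sup>2))"
  proof -
    have "(\<lambda>x. (q x - lam * w x) * (g x * (norm (f x))\<^sup>2))
        = (\<lambda>x. q x * (g x * (norm (f x))\<^sup>2) - lam * (w x * (g x * (norm (f x))\<^sup>2)))"
      by (simp add: algebra_simps)
    then show ?thesis using int by simp
  qed
  have t1: "\<bar>LINT x|?M. 1 / p x * (g x * (norm (u x))\<^sup>2)\<bar> \<le> L * K\<^sup>2"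
  proof -
    have "norm (LINT x|?M. 1 / p x * (g x * (norm (u x))\<^sup>2)) \<le> (LINT x|?M. L * (1 / p x * (norm (u x))\<^sup>2))"
    proof (rule integral_norm_bound_AE)
      show "integrable ?M (\<lambda>x. L * (1 / p x * (norm (u x))\<^sup>2))" by (intro integrable_mult_right int)
      show "AE x in ?M. norm (1 / p x * (g x * (norm (u x))\<^sup>2)) \<le> L * (1 / p x * (norm (u x))\<^sup>2)"
        using pos L
      proof eventually_elim
        case (elim x)
        have "norm (1 / p x * (g x * (norm (u x))\<^sup>2)) = \<bar>g x\<bar> * (1 / p x * (norm (u x))\<^sup>2)"
          using elim(1) by (simp add: abs_mult)
        also have "\<dots> \<le> L * (1 / p x * (norm (u x))\<^sup>2)"
          using elim by (intro mult_right_mono) simp_all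
        finally show ?case .
      qed
    qed (use int in simp)
    also have "\<dots> = L * K\<^sup>2" unfolding K_def using K0 by (subst integral_mult_right_zero) simp
    finally show ?thesis by simp
  qed
  have t2: "\<bar>LINT x|?M. q x * (g x * (norm (f x))\<^sup>2)\<bar> \<le> L * (norm_L1 a b q * B\<^sup>2)"
  proof -
    have "norm (LINT x|?M. q x * (g x * (norm (f x))\<^sup>2)) \<le> (LINT x|?M. (L * B\<^sup>2) * \<bar>q x\<bar>)"
    proof (rule integral_norm_bound_AE)
      show "integrable ?M (\<lambda>x. (L * B\<^sup>2) * \<bar>q x\<bar>)" using q by simp
      show "AE x in ?M. norm (q x * (g x * (norm (f x))\<^sup>2)) \<le> (L * B\<^sup>2) * \<bar>q x\<bar>"
        using L AE_space
      proof eventually_elim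
        case (elim x)
        have "norm (q x * (g x * (norm (f x))\<^sup>2)) = (\<bar>g x\<bar> * (norm (f x))\<^sup>2) * \<bar>q x\<bar>"
          by (simp add: abs_mult)
        also have "\<dots> \<le> (L * B\<^sup>2) * \<bar>q x\<bar>"
          using elim B[of x] \<open>L \<ge> 0\<close> by (intro mult_right_mono mult_mono power_mono) simp_all
        finally show ?case .
      qed
    qed (use int in simp)
    also have "\<dots> = L * (norm_L1 a b q * B\<^sup>2)"
      by (subst integral_mult_right_zero) (simp add: norm_L1_def)
    finally show ?thesis by simp
  qed
  have t3: "\<bar>LINT x|?M. g' x * (u x \<bullet> f x)\<bar> \<le> B * (F * K)"
  proof -
    \<comment> \<open>The square roots of \<open>p\<close> in \<open>?h\<close> and
      \<open>?k\<close> cancel, so \<open>?h x * ?k x\<close> is \<open>g' x * norm (u x)\<close>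
      a.e.\<close>
    let ?k = "\<lambda>x. sqrt (1 / p x) * norm (u x)"
    have k2: "AE x in ?M. (?k x)\<^sup>2 = 1 / p x * (norm (u x))\<^sup>2"
      using pos by eventually_elim (simp add: power_mult_distrib)
    have k2i: "integrable ?M (\<lambda>x. (?k x)\<^sup>2)"
      using int by (subst integrable_cong_AE[OF _ _ k2]; simp)
    have sqe: "(LINT x|?M. (?h x)\<^sup>2) = (LINT x|?M. p x * (g' x)\<^sup>2)"
        "(LINT x|?M. (?k x)\<^sup>2) = (LINT x|?M. 1 / p x * (norm (u x))\<^sup>2)"
      by (rule integral_cong_AE[OF _ _ h2], simp, simp, rule integral_cong_AE[OF _ _ k2], simp, simp)
    have "norm (LINT x|?M. g' x * (u x \<bullet> f x)) \<le> (LINT x|?M. B * \<bar>g' x * norm (u x)\<bar>)"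
    proof (rule integral_norm_bound_AE)
      show "integrable ?M (\<lambda>x. B * \<bar>g' x * norm (u x)\<bar>)"
        by (intro integrable_mult_right Bochner_Integration.integrable_abs int)
      show "AE x in ?M. norm (g' x * (u x \<bullet> f x)) \<le> B * \<bar>g' x * norm (u x)\<bar>"
      proof (rule AE_I2)
        fix x assume x: "x \<in> space ?M"
        have "\<bar>u x \<bullet> f x\<bar> \<le> norm (u x) * norm (f x)" by (rule Cauchy_Schwarz_ineq2)
        also have "\<dots> \<le> norm (u x) * B" using B[of x] x by (intro mult_left_mono) simp_all
        finally have "\<bar>g' x\<bar> * \<bar>u x \<bullet> f x\<bar> \<le> \<bar>g' x\<bar> * (norm (u x) * B)"
          by (rule mult_left_mono) simp
        then show "norm (g' x * (u x \<bullet> f x)) \<le> B * \<bar>g' x * norm (u x)\<bar>"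
          by (simp add: abs_mult ac_simps)
      qed
    qed (use int in simp)
    also have "\<dots> = B * (LINT x|?M. \<bar>g' x * norm (u x)\<bar>)" by (rule integral_mult_right_zero)
    also have "(LINT x|?M. \<bar>g' x * norm (u x)\<bar>) = (LINT x|?M. \<bar>?h x * ?k x\<bar>)"
    proof (rule integral_cong_AE)
      show "AE x in ?M. \<bar>g' x * norm (u x)\<bar> = \<bar>?h x * ?k x\<bar>"
        using cancel
      proof eventually_elim
        case (elim x)
        have "?h x * ?k x = (?h x * sqrt (1 / p x)) * norm (u x)" by (simp only: ac_simps)
        then show ?case by (simp only: elim)
      qed
    qed measurable
    also have "B * \<dots> \<le> B * (F * K)"
      using Cauchy_Schwarz_integral(2)[OF _ _ h2i k2i] \<open>B \<ge> 0\<close>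
      unfolding sqe K_def F_def by (intro mult_left_mono) simp_all
    finally show ?thesis by simp
  qed
  show ?thesis
    using id t1 t2 t3 unfolding split distrib_left by linarith
qed

text \<open>Off the exceptional set \<open>g w \<ge> \<epsilon> / p\<close>. On it,
  \<open>\<epsilon> (\<bar>f\<bar>\<^sup>2 - B\<^sup>2) / p \<le> 0 \<le> g w
  \<bar>f\<bar>\<^sup>2\<close>. Subtracting \<open>B\<^sup>2 / p\<close> on that set gives one
  pointwise inequality, which is integrated.\<close>

lemma weighted_norm_ge:
  fixes f :: "real \<Rightarrow> 'a::euclidean_space" and g :: "real \<Rightarrow> real"
  assumes f: "continuous_on {a..b} f" and g: "continuous_on {a..b} g"
    and p: "integrable (lebesgue_on {a<..<b}) (\<lambda>x. 1 / p x)"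
    and pos: "AE x in lebesgue_on {a<..<b}. p x > 0"
    and pm: "p \<in> borel_measurable (lebesgue_on {a<..<b})"
    and w: "integrable (lebesgue_on {a<..<b}) w"
    and gw: "AE x in lebesgue_on {a<..<b}. g x * w x > 0"
    and "\<epsilon> > 0" and "\<delta> \<ge> 0"
    and E: "emeasure (weight_measure a b (\<lambda>x. 1 / p x)) {x \<in> {a<..<b}. p x * g x * w x < \<epsilon>} \<le> ennreal \<delta>"
    and B: "\<And>x. x \<in> {a..b} \<Longrightarrow> norm (f x) \<le> B"
  shows "\<epsilon> * ((LINT x|lebesgue_on {a<..<b}. 1 / p x * (norm (f x))\<^sup>2) - B\<^sup>2 * \<delta>)
           \<le> (LINT x|lebesgue_on {a<..<b}. w x * (g x * (norm (f x))\<^sup>2))"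
proof -
  let ?M = "lebesgue_on {a<..<b}"
  let ?E = "{x \<in> {a<..<b}. p x * g x * w x < \<epsilon>}"
  have [measurable]: "p \<in> borel_measurable ?M" "g \<in> borel_measurable ?M" "w \<in> borel_measurable ?M"
    by (fact pm, rule continuous_on_Icc_measurable_lebesgue_on[OF g], use w in simp)
  have "{x \<in> space ?M. p x * g x * w x < \<epsilon>} \<in> sets ?M" by measurable
  then have Em [measurable]: "?E \<in> sets ?M" by simp
  have Ei: "integrable ?M (\<lambda>x. 1 / p x * indicator ?E x)"
    by (rule integrable_real_mult_indicator[OF Em p])
  have int: "integrable ?M (\<lambda>x. 1 / p x * (norm (f x))\<^sup>2)" "integrable ?M (\<lambda>x. w x * (g x * (norm (f x))\<^sup>2))"
    by (intro integrable_mult_continuous_on p w continuous_intros f g)+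
  \<comment> \<open>The measure hypothesis is turned into a bound on the real integral of
    \<open>1 / p\<close> over the exceptional set.\<close>
  have "emeasure (weight_measure a b (\<lambda>x. 1 / p x)) ?E = (\<integral>\<^sup>+x. ennreal (1 / p x) * indicator ?E x \<partial>?M)"
    unfolding weight_measure_def by (intro emeasure_density Em) measurable
  also have "\<dots> = (\<integral>\<^sup>+x. ennreal (1 / p x * indicator ?E x) \<partial>?M)"
    by (intro nn_integral_cong) (simp split: split_indicator)
  also have "\<dots> = ennreal (LINT x|?M. 1 / p x * indicator ?E x)"
    using pos by (intro nn_integral_eq_integral Ei) (auto elim!: eventually_mono split: split_indicator)
  finally have Eb: "(LINT x|?M. 1 / p x * indicator ?E x) \<le> \<delta>"
    using E \<open>\<delta> \<ge> 0\<close> by simp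
  have "\<epsilon> * ((LINT x|?M. 1 / p x * (norm (f x))\<^sup>2) - B\<^sup>2 * \<delta>)
      \<le> \<epsilon> * ((LINT x|?M. 1 / p x * (norm (f x))\<^sup>2) - B\<^sup>2 * (LINT x|?M. 1 / p x * indicator ?E x))"
    using Eb \<open>\<epsilon> > 0\<close> by (intro mult_left_mono diff_left_mono) simp_all
  also have "\<dots> = (LINT x|?M. \<epsilon> * (1 / p x * (norm (f x))\<^sup>2 - B\<^sup>2 * (1 / p x * indicator ?E x)))"
    by (simp only: integral_mult_right_zero
        Bochner_Integration.integral_diff[OF int(1) integrable_mult_right[OF Ei]])
  also have "\<dots> \<le> (LINT x|?M. w x * (g x * (norm (f x))\<^sup>2))"
  proof (rule integral_mono_AE)
    show "integrable ?M (\<lambda>x. \<epsilon> * (1 / p x * (norm (f x))\<^sup>2 - B\<^sup>2 * (1 / p x * indicator ?E x)))"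
      by (intro integrable_mult_right Bochner_Integration.integrable_diff int Ei)
    show "AE x in ?M. \<epsilon> * (1 / p x * (norm (f x))\<^sup>2 - B\<^sup>2 * (1 / p x * indicator ?E x))
        \<le> w x * (g x * (norm (f x))\<^sup>2)"
      using pos gw AE_space
    proof eventually_elim
      case (elim x)
      have r: "w x * (g x * (norm (f x))\<^sup>2) = (g x * w x) * (norm (f x))\<^sup>2" by (simp only: ac_simps)
      show ?case
      proof (cases "x \<in> ?E")
        case True
        have "(norm (f x))\<^sup>2 \<le> B\<^sup>2" using B[of x] elim(3) by (intro power_mono) simp_all
        then have "1 / p x * (norm (f x))\<^sup>2 \<le> 1 / p x * B\<^sup>2"
          using elim(1) by (intro mult_left_mono) simp_all
        then have "\<epsilon> * (1 / p x * (norm (f x))\<^sup>2 - B\<^sup>2 * (1 / p x)) \<le> 0"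
          using \<open>\<epsilon> > 0\<close> by (intro mult_nonneg_nonpos) (simp_all add: mult.commute)
        also have "\<dots> \<le> (g x * w x) * (norm (f x))\<^sup>2" using elim(2) by simp
        finally show ?thesis unfolding r using True by simp
      next
        case False
        then have "\<epsilon> \<le> p x * g x * w x" using elim(3) by simp
        then have "\<epsilon> / p x \<le> g x * w x"
          using elim(1) by (simp add: pos_divide_le_eq ac_simps)
        then have "\<epsilon> / p x * (norm (f x))\<^sup>2 \<le> (g x * w x) * (norm (f x))\<^sup>2"
          by (rule mult_right_mono) simp
        then show ?thesis unfolding r using False by simp
      qed
    qed
  qed (rule int)
  finally show ?thesis .
qed

section \<open>Nondegeneracy of the norms and assembly of the eigenvalue bound\<close>

lemma bc_const_nonneg: "bc_const D \<ge> 0"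
  by (cases D rule: bc_const.cases) auto

text \<open>The interval has positive measure; this is what turns an absurd a.e. statement into a
  contradiction in the next two lemmas.\<close>

lemma not_AE_False_lebesgue_on_Ioo:
  fixes a b :: real
  assumes "a < b"
  shows "\<not> (AE x in lebesgue_on {a<..<b}. False)"
proof
  assume "AE x in lebesgue_on {a<..<b}. False"
  then have "emeasure (lebesgue_on {a<..<b}) {a<..<b} = 0"
    by (subst (asm) AE_iff_measurable[of "{a<..<b}"]) (auto simp: sets_restrict_space_iff)
  then show False using assms by (simp add: emeasure_restrict_space)
qed

text \<open>Since \<open>real_of_ereal\<close> sends infinite values to 0, the essential supremum
  must first be shown finite. Compactness bounds it from above, and it is nonnegative because the
  interval is not a null set.\<close>

lemma norm_Linf_continuous_on:
  fixes g :: "real \<Rightarrow> real"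
  assumes "a < b" and g: "continuous_on {a..b} g"
  shows "AE x in lebesgue_on {a<..<b}. \<bar>g x\<bar> \<le> norm_Linf a b g" and "norm_Linf a b g \<ge> 0"
proof -
  let ?M = "lebesgue_on {a<..<b}"
  let ?s = "esssup ?M (\<lambda>x. ereal \<bar>g x\<bar>)"
  obtain B where B: "\<And>x. x \<in> {a..b} \<Longrightarrow> norm (g x) \<le> B"
    using continuous_on_Icc_norm_bound[OF g] by blast
  have [measurable]: "g \<in> borel_measurable ?M" by (rule continuous_on_Icc_measurable_lebesgue_on[OF g])
  have "?s \<le> ereal B"
    by (rule esssup_I, measurable, rule AE_I2) (use B in simp)
  moreover have AE: "AE x in ?M. ereal \<bar>g x\<bar> \<le> ?s" by (rule esssup_AE)
  have "?s \<ge> 0"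
  proof (rule ccontr)
    assume neg: "\<not> ?s \<ge> 0"
    have "AE x in ?M. False" using AE
    proof eventually_elim
      case (elim x)
      have "(0 :: ereal) \<le> ereal \<bar>g x\<bar>" by simp
      with elim neg show ?case using order_trans by blast
    qed
    then show False using not_AE_False_lebesgue_on_Ioo[OF \<open>a < b\<close>] by simp
  qed
  ultimately obtain c where c: "?s = ereal c" "c \<ge> 0"
    by (cases ?s) auto
  then show "norm_Linf a b g \<ge> 0" by (simp add: norm_Linf_def)
  show "AE x in ?M. \<bar>g x\<bar> \<le> norm_Linf a b g" using AE by (simp add: norm_Linf_def c(1))
qed

text \<open>A zero norm would force \<open>1 / p = 0\<close> a.e., against \<open>p > 0\<close>.
  Positivity legitimises the divisions by this norm in \<open>\<beta>\<close> and
  \<open>\<gamma>\<close>.\<close>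

lemma norm_L1_inverse_pos:
  assumes "a < b" and p: "integrable (lebesgue_on {a<..<b}) (\<lambda>x. 1 / p x)"
    and pos: "AE x in lebesgue_on {a<..<b}. p x > 0"
  shows "norm_L1 a b (\<lambda>x. 1 / p x) > 0"
proof (rule ccontr)
  assume "\<not> norm_L1 a b (\<lambda>x. 1 / p x) > 0"
  then have "(LINT x|lebesgue_on {a<..<b}. \<bar>1 / p x\<bar>) = 0"
    using norm_L1_nonneg[of a b "\<lambda>x. 1 / p x"] unfolding norm_L1_def by linarith
  then have "AE x in lebesgue_on {a<..<b}. \<bar>1 / p x\<bar> = 0"
    by (subst (asm) integral_nonneg_eq_0_iff_AE) (intro Bochner_Integration.integrable_abs p, simp_all)
  with pos have "AE x in lebesgue_on {a<..<b}. False"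
    by eventually_elim simp
  with not_AE_False_lebesgue_on_Ioo[OF \<open>a < b\<close>] show False by simp
qed

text \<open>The density is built with \<open>ennreal\<close>, which truncates negative values to 0;
  a.e. positivity of \<open>p\<close> makes it agree with the ordinary weighted integral.\<close>

lemma L2_weightD:
  fixes h :: "real \<Rightarrow> 'a::{banach, second_countable_topology}"
  assumes h: "h \<in> L2_weight a b p"
    and [measurable]: "p \<in> borel_measurable (lebesgue_on {a<..<b})"
    and pos: "AE x in lebesgue_on {a<..<b}. p x > 0"
  shows "h \<in> borel_measurable (lebesgue_on {a<..<b})"
    and "integrable (lebesgue_on {a<..<b}) (\<lambda>x. p x * (norm (h x))\<^sup>2)"
    and "norm_L2_weight a b p h = sqrt (LINT x|lebesgue_on {a<..<b}. p x * (norm (h x))\<^sup>2)"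
proof -
  let ?M = "lebesgue_on {a<..<b}"
  have pos': "AE x in ?M. 0 \<le> p x" using pos by eventually_elim simp
  show hm [measurable]: "h \<in> borel_measurable ?M"
    using h by (simp add: L2_weight_def weight_measure_def)
  have "integrable (density ?M (\<lambda>x. ennreal (p x))) (\<lambda>x. (norm (h x))\<^sup>2)"
    using h by (simp add: L2_weight_def weight_measure_def)
  then show "integrable ?M (\<lambda>x. p x * (norm (h x))\<^sup>2)"
    by (subst (asm) integrable_density[OF _ _ pos']) simp_all
  show "norm_L2_weight a b p h = sqrt (LINT x|?M. p x * (norm (h x))\<^sup>2)"
    unfolding norm_L2_weight_def weight_measure_def
    by (subst integral_density[OF _ _ pos']) simp_all
qed

theorem theorem4p3:
  fixes a b \<epsilon> \<alpha> \<beta> \<gamma> :: real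
    and p q w g g' :: "real \<Rightarrow> real"
    and D :: bound_cond
  assumes "a < b"
    and "p \<in> borel_measurable (lebesgue_on {a<..<b})"
    and "q \<in> borel_measurable (lebesgue_on {a<..<b})"
    and "w \<in> borel_measurable (lebesgue_on {a<..<b})"
    and "integrable (lebesgue_on {a<..<b}) (\<lambda>x. 1 / p x)"
    and "integrable (lebesgue_on {a<..<b}) q"
    and "integrable (lebesgue_on {a<..<b}) w"
    and "AE x in lebesgue_on {a<..<b}. p x > 0"
    and "AE x in lebesgue_on {a<..<b}. w x \<noteq> 0"
    and "emeasure lebesgue {x \<in> {a<..<b}. w x > 0} > 0"
    and "emeasure lebesgue {x \<in> {a<..<b}. w x < 0} > 0"
    and "admissible D"
    and "\<alpha> = bc_const D + norm_L1 a b (\<lambda>x. min 0 (q x))"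
    and "\<beta> = sqrt (\<alpha> * (1 / norm_L1 a b (\<lambda>x. 1 / p x) + \<alpha>)) + \<alpha>"
    and "\<gamma> = sqrt (2 * \<beta> + 1 / norm_L1 a b (\<lambda>x. 1 / p x))"
    and "abs_cont_on a b g"
    and "AE x in lebesgue_on {a<..<b}. g x * w x > 0"
    and "g a = 0" and "g b = 0"
    and "AE x in lebesgue_on {a<..<b}. (g has_real_derivative g' x) (at x)"
    and "g' \<in> L2_weight a b p"
    and "\<epsilon> > 0"
    and "emeasure (weight_measure a b (\<lambda>x. 1 / p x)) {x \<in> {a<..<b}. p x * g x * w x < \<epsilon>}
           \<le> ennreal (1 / (2 * \<gamma>\<^sup>2))"
  shows "\<forall>lam. real_exceptional a b p q w D lam \<longrightarrow>
           \<bar>lam\<bar> \<le> 2 / \<epsilon> * (\<beta> * \<gamma> * norm_L2_weight a b p g'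
                       + (\<beta>\<^sup>2 + \<gamma>\<^sup>2 * norm_L1 a b q) * norm_Linf a b g)"
proof (intro allI impI)
  fix lam assume exc: "real_exceptional a b p q w D lam"
  let ?M = "lebesgue_on {a<..<b}"
  let ?P = "norm_L1 a b (\<lambda>x. 1 / p x)"
  define F L Q where "F = norm_L2_weight a b p g'" and "L = norm_Linf a b g" and "Q = norm_L1 a b q"
  note ab = assms(1) and pm = assms(2) and p = assms(5) and q = assms(6) and w = assms(7)
    and pos = assms(8) and \<alpha> = assms(13) and \<beta> = assms(14) and \<gamma> = assms(15) and g = assms(16)
    and gw = assms(17) and dg = assms(20) and \<epsilon> = assms(22)
  have P: "?P > 0" by (rule norm_L1_inverse_pos[OF ab p pos])
  have "\<alpha> \<ge> 0" unfolding \<alpha> by (intro add_nonneg_nonneg bc_const_nonneg norm_L1_nonneg)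
  note c = sobolev_constants[OF this P \<beta> \<gamma>]
  note contg = abs_cont_on_imp_continuous_on[OF g]
  note Linf = norm_Linf_continuous_on[OF ab contg, folded L_def]
  have "Q \<ge> 0" by (simp add: Q_def norm_L1_nonneg)
  note g' = L2_weightD[OF assms(21) pm pos]
  have F: "F = sqrt (LINT x|?M. p x * (g' x)\<^sup>2)" using g'(3) by (simp add: F_def)
  have "F \<ge> 0" unfolding F_def norm_L2_weight_def by simp
  let ?R = "\<beta> * \<gamma> * F + (\<beta>\<^sup>2 + \<gamma>\<^sup>2 * Q) * L"
  have R: "?R \<ge> 0" using c(1,2) \<open>F \<ge> 0\<close> \<open>Q \<ge> 0\<close> Linf(2) by simp
  have "\<bar>lam\<bar> \<le> 2 / \<epsilon> * ?R"
  proof (cases "lam = 0")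
    \<comment> \<open>For eigenvalue 0 the claim is the nonnegativity of the right-hand
      side.\<close>
    case True
    then show ?thesis using R \<epsilon> by simp
  next
    case False
    then obtain f where f: "is_eigenfunction a b p q w D (of_real lam) f"
      and sgn: "lam * (LINT x|?M. (norm (f x))\<^sup>2 * w x) \<le> 0"
      using exc by (auto simp: real_exceptional_def)
    define u where "u = quasi_deriv a b p f"
    note E = is_eigenfunctionD[OF f pos, folded u_def]
    note contf = abs_cont_on_imp_continuous_on[OF E(1)]
    define N where "N = sqrt (LINT x|?M. 1 / p x * (norm (f x))\<^sup>2)"
    define K where "K = sqrt (LINT x|?M. 1 / p x * (norm (u x))\<^sup>2)"
    have bc: "u b \<bullet> f b - u a \<bullet> f a \<le> bc_const D * B\<^sup>2" if "norm (f a) \<le> B" "norm (f b) \<le> B" for B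
      unfolding u_def by (rule boundary_form_le[OF E(3) assms(12) that])
    note bounds = eigenfunction_bounds[OF ab E(1,2,4,5) p pos pm P q w bc bc_const_nonneg sgn \<alpha> \<beta> \<gamma>,
        folded N_def K_def]
    have fsq: "integrable ?M (\<lambda>x. 1 / p x * (norm (f x))\<^sup>2)"
      by (intro integrable_mult_continuous_on p continuous_intros contf)
    have pnn: "AE x in ?M. 0 \<le> 1 / p x * (norm (v x))\<^sup>2" for v :: "real \<Rightarrow> complex"
      using pos by eventually_elim simp
    have N2: "N\<^sup>2 = (LINT x|?M. 1 / p x * (norm (f x))\<^sup>2)"
      unfolding N_def by (rule real_sqrt_pow2) (rule integral_nonneg_AE[OF pnn])
    have "N \<ge> 0" "K \<ge> 0" unfolding N_def K_def
      by (rule real_sqrt_ge_zero, rule integral_nonneg_AE[OF pnn])+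
    \<comment> \<open>An eigenfunction is not a.e. zero, so \<open>N\<^sup>2\<close> can be
      cancelled at the end.\<close>
    have "N \<noteq> 0"
    proof
      assume "N = 0"
      then have "(LINT x|?M. 1 / p x * (norm (f x))\<^sup>2) = 0" using N2 by simp
      then have "AE x in ?M. 1 / p x * (norm (f x))\<^sup>2 = 0"
        using integral_nonneg_eq_0_iff_AE[OF fsq pnn] by simp
      then have "AE x in ?M. f x = 0" using pos by eventually_elim simp
      then show False using f by (simp add: is_eigenfunction_def)
    qed
    then have "N\<^sup>2 > 0" by simp
    \<comment> \<open>The sup bound \<open>\<gamma> * N\<close> is used as \<open>B\<close>;
      replacing \<open>K\<close> by \<open>\<beta> * N\<close> afterwards makes the whole estimate a
      multiple of \<open>N\<^sup>2\<close>.\<close>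
    have "\<bar>lam * (LINT x|?M. w x * (g x * (norm (f x))\<^sup>2))\<bar>
        \<le> (\<gamma> * N) * (F * K) + L * (K\<^sup>2 + Q * (\<gamma> * N)\<^sup>2)"
      unfolding F K_def Q_def
      by (rule weighted_eigenvalue_le[OF less_imp_le[OF ab] E(1,2) g E(4,5) dg p pos pm q w g'(1) _
            assms(18,19) Linf bounds(1)]) (use g'(2) in simp_all)
    also have "\<dots> \<le> (\<gamma> * N) * (F * (\<beta> * N)) + L * ((\<beta> * N)\<^sup>2 + Q * (\<gamma> * N)\<^sup>2)"
      using bounds(2) c(1,2) \<open>N \<ge> 0\<close> \<open>K \<ge> 0\<close> \<open>F \<ge> 0\<close> Linf(2)
      by (intro add_mono mult_left_mono power_mono add_right_mono) simp_all
    also have "\<dots> = ?R * N\<^sup>2" by (simp add: power2_eq_square algebra_simps)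
    finally have upper: "\<bar>lam\<bar> * \<bar>LINT x|?M. w x * (g x * (norm (f x))\<^sup>2)\<bar> \<le> ?R * N\<^sup>2"
      by (simp add: abs_mult)
    \<comment> \<open>With \<open>B = \<gamma> * N\<close> and the assumed bound
      \<open>1 / (2 * \<gamma>\<^sup>2)\<close> for the measure, the exceptional set costs exactly
      half of \<open>N\<^sup>2\<close>. This is the origin of the factor 2 in the result.\<close>
    have ge: "\<epsilon> * (N\<^sup>2 - (\<gamma> * N)\<^sup>2 * (1 / (2 * \<gamma>\<^sup>2))) \<le> (LINT x|?M. w x * (g x * (norm (f x))\<^sup>2))"
      unfolding N2 by (rule weighted_norm_ge[OF contf contg p pos pm w gw \<epsilon> _ assms(23) bounds(1)]) simp_all
    have half: "(\<gamma> * N)\<^sup>2 * (1 / (2 * \<gamma>\<^sup>2)) = N\<^sup>2 / 2"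
      using c(2) by (simp add: power_mult_distrib)
    have lower: "\<epsilon> * N\<^sup>2 / 2 \<le> \<bar>LINT x|?M. w x * (g x * (norm (f x))\<^sup>2)\<bar>"
      using ge unfolding half by (simp add: right_diff_distrib)
    have "\<bar>lam\<bar> * (\<epsilon> * N\<^sup>2 / 2) \<le> ?R * N\<^sup>2"
      using mult_left_mono[OF lower, of "\<bar>lam\<bar>"] upper by simp
    then have "(\<bar>lam\<bar> * \<epsilon> / 2) * N\<^sup>2 \<le> ?R * N\<^sup>2" by (simp add: ac_simps)
    then have "\<bar>lam\<bar> * \<epsilon> / 2 \<le> ?R" using \<open>N\<^sup>2 > 0\<close> by (rule mult_right_le_imp_le)
    then show ?thesis using \<epsilon> by (simp add: pos_le_divide_eq mult.commute)
  qed
  then show "\<bar>lam\<bar> \<le> 2 / \<epsilon> * (\<beta> * \<gamma> * norm_L2_weight a b p g'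
      + (\<beta>\<^sup>2 + \<gamma>\<^sup>2 * norm_L1 a b q) * norm_Linf a b g)"
    by (simp only: F_def L_def Q_def)
qed

end
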